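(* Let $\gamma>1$, $T>0$ and $R_0>0$. Consider triples $(\rho,\mathbf u,R(t))$ of the spherically symmetric form $$\rho(\mathbf x,t)=\rho(|\mathbf x|,t),\qquad \mathbf u(\mathbf x,t)=u(|\mathbf x|,t)\,\mathbf x/|\mathbf x|,$$ solving the free boundary problem for the three-dimensional compressible Euler equations $$\begin{cases}\partial_t\rho+\operatorname{div}(\rho\mathbf u)=0, & 0<|\mathbf x|<R(t),\ t\in[0,T],\\ \partial_t(\rho\mathbf u)+\operatorname{div}(\rho\mathbf u\otimes\mathbf u)+\nabla_{\mathbf x}(\rho^\gamma)=0, & 0<|\mathbf x|<R(t),\ t\in[0,T],\\ \rho>0, & 0\le|\mathbf x|<R(t),\ t\in[0,T],\\ \rho=0, & |\mathbf x|=R(t),\ t\in[0,T],\\ \mathbf u(\mathbf 0,t)=\mathbf 0, & t\in[0,T],\\ \mathcal V(\partial B_{R(t)})=\mathbf u|_{\partial B_{R(t)}}\cdot\mathbf n, & t\in[0,T],\\ (\rho,\mathbf u)(\mathbf x,0)=(\rho_0,\mathbf u_0), & |\mathbf x|\le R_0,\end{cases}$$ with $R(0)=R_0$ and given spherically symmetric initial data $(\rho_0,\mathbf u_0)$. Such solutions are unique (i.e. two such solutions with the same initial data and the same $R_0$ coincide on $[0,T]$) provided they satisfy the regularity conditions $$R(t)\in C^1([0,T])\quad\text{and}\quad(\rho,\mathbf u)\in C^1\cap W^{1,\infty}\big(\{(\mathbf x,t)\in\mathbb R^3\times[0,T]:0<|\mathbf x|\le R(t)\}\big).$$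
   Context: $B_{R(t)}=\{\mathbf x\in\mathbb R^3:|\mathbf x|<R(t)\}$; $\mathcal V(\partial B_{R(t)})$ is the normal velocity of the moving sphere $\partial B_{R(t)}$ and $\mathbf n$ its exterior unit normal, so the kinematic condition reads $\dot R(t)=u(R(t),t)$. The solutions are not required to be differentiable at the origin $\mathbf x=\mathbf 0$, and no physical vacuum condition is imposed at the boundary. *)

theory Defs
  imports "HOL-Analysis.Analysis"
begin

type_synonym point = "real ^ 3"

subsection \<open>Differential operators\<close>

definition partial :: "'n::finite \<Rightarrow> (real ^ 'n \<Rightarrow> real) \<Rightarrow> real ^ 'n \<Rightarrow> real" where
  "partial i f x = frechet_derivative f (at x) (axis i 1)"

definition gradient :: "(real ^ 'n::finite \<Rightarrow> real) \<Rightarrow> real ^ 'n \<Rightarrow> real ^ 'n" where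
  "gradient f x = (\<chi> i. partial i f x)"

definition divergence :: "(real ^ 'n::finite \<Rightarrow> real ^ 'n) \<Rightarrow> real ^ 'n \<Rightarrow> real" where
  "divergence F x = (\<Sum>j\<in>UNIV. partial j (\<lambda>y. F y $ j) x)"

definition tensor_divergence ::
    "(real ^ 'n::finite \<Rightarrow> real ^ 'n ^ 'n) \<Rightarrow> real ^ 'n \<Rightarrow> real ^ 'n" where
  "tensor_divergence A x = (\<chi> i. divergence (\<lambda>y. A y $ i) x)"

definition outer :: "real ^ 'n::finite \<Rightarrow> real ^ 'n \<Rightarrow> real ^ 'n ^ 'n" where
  "outer a b = (\<chi> i j. a $ i * b $ j)"

text \<open>One-sided at the end points of the time interval.\<close>

definition time_deriv :: "real \<Rightarrow> (real \<Rightarrow> 'a::real_normed_vector) \<Rightarrow> real \<Rightarrow> 'a" where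
  "time_deriv T f t = vector_derivative f (at t within {0..T})"

subsection \<open>Function classes\<close>

text \<open>
  The sets below are not open. Being \<open>C\<^sup>1\<close> on such a set means differentiability relative
  to the set, with a derivative that is continuous on it, boundary points included.
\<close>

definition C1_on :: "'a::real_normed_vector set \<Rightarrow> ('a \<Rightarrow> 'b::real_normed_vector) \<Rightarrow> bool" where
  "C1_on S f \<longleftrightarrow> (\<exists>f' :: 'a \<Rightarrow> 'a \<Rightarrow>\<^sub>L 'b.
     (\<forall>p\<in>S. (f has_derivative blinfun_apply (f' p)) (at p within S)) \<and>
     continuous_on S f')"

text \<open>
  \<open>C\<^sup>1 \<inter> W\<^sup>1\<^sup>,\<^sup>\<infinity>\<close>: the weak first derivatives of a \<open>C\<^sup>1\<close> function are its classical ones, and for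
  continuous functions (on a set contained in the closure of its interior) essential
  boundedness is boundedness.
\<close>

definition C1_W1inf_on :: "'a::real_normed_vector set \<Rightarrow> ('a \<Rightarrow> 'b::real_normed_vector) \<Rightarrow> bool" where
  "C1_W1inf_on S f \<longleftrightarrow> (\<exists>f' :: 'a \<Rightarrow> 'a \<Rightarrow>\<^sub>L 'b.
     (\<forall>p\<in>S. (f has_derivative blinfun_apply (f' p)) (at p within S)) \<and>
     continuous_on S f' \<and>
     bounded (f ` S) \<and> bounded (f' ` S))"

subsection \<open>Spherical symmetry\<close>

definition radial_scalar_on :: "point set \<Rightarrow> (point \<Rightarrow> real) \<Rightarrow> bool" where
  "radial_scalar_on D f \<longleftrightarrow> (\<exists>g :: real \<Rightarrow> real. \<forall>x\<in>D. f x = g (norm x))"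

definition radial_vector_on :: "point set \<Rightarrow> (point \<Rightarrow> point) \<Rightarrow> bool" where
  "radial_vector_on D f \<longleftrightarrow>
     (\<exists>g :: real \<Rightarrow> real. \<forall>x\<in>D - {0}. f x = g (norm x) *\<^sub>R (x /\<^sub>R norm x))"

subsection \<open>The free boundary problem\<close>

text \<open>
  The normal velocity of the sphere of radius \<open>R t\<close> is the time derivative of \<open>R\<close>, and its
  exterior unit normal at \<open>x\<close> is \<open>x /\<^sub>R norm x\<close>.
\<close>

definition euler_fb_solution ::
    "real \<Rightarrow> real \<Rightarrow> real \<Rightarrow> (point \<Rightarrow> real) \<Rightarrow> (point \<Rightarrow> point) \<Rightarrow>
     (point \<Rightarrow> real \<Rightarrow> real) \<Rightarrow> (point \<Rightarrow> real \<Rightarrow> point) \<Rightarrow> (real \<Rightarrow> real) \<Rightarrow> bool" where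
  "euler_fb_solution \<gamma> T R\<^sub>0 \<rho>\<^sub>0 u\<^sub>0 \<rho> u R \<longleftrightarrow>
     R 0 = R\<^sub>0 \<and>
     (\<forall>x. norm x \<le> R\<^sub>0 \<longrightarrow> \<rho> x 0 = \<rho>\<^sub>0 x \<and> u x 0 = u\<^sub>0 x) \<and>
     (\<forall>t\<in>{0..T}.
        R t > 0 \<and>
        radial_scalar_on (cball 0 (R t)) (\<lambda>x. \<rho> x t) \<and>
        radial_vector_on (cball 0 (R t)) (\<lambda>x. u x t) \<and>
        (\<forall>x. 0 < norm x \<and> norm x < R t \<longrightarrow>
           time_deriv T (\<lambda>s. \<rho> x s) t + divergence (\<lambda>y. \<rho> y t *\<^sub>R u y t) x = 0 \<and>
           time_deriv T (\<lambda>s. \<rho> x s *\<^sub>R u x s) t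
             + tensor_divergence (\<lambda>y. \<rho> y t *\<^sub>R outer (u y t) (u y t)) x
             + gradient (\<lambda>y. \<rho> y t powr \<gamma>) x = 0) \<and>
        (\<forall>x. norm x < R t \<longrightarrow> \<rho> x t > 0) \<and>
        (\<forall>x. norm x = R t \<longrightarrow> \<rho> x t = 0) \<and>
        u 0 t = 0 \<and>
        (\<forall>x. norm x = R t \<longrightarrow> time_deriv T R t = u x t \<bullet> (x /\<^sub>R norm x)))"

definition punctured_tube :: "real \<Rightarrow> (real \<Rightarrow> real) \<Rightarrow> (point \<times> real) set" where
  "punctured_tube T R = {(x, t). t \<in> {0..T} \<and> 0 < norm x \<and> norm x \<le> R t}"

text \<open>
  Differentiability is only asked away from the origin. A function in \<open>W\<^sup>1\<^sup>,\<^sup>\<infinity>\<close> has a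
  continuous extension to \<open>x = 0\<close>; the second conjunct says that the values of the density at
  the origin, which enter the problem through \<open>\<rho> 0 t > 0\<close>, are those of this extension. For the
  velocity this follows from \<open>u 0 t = 0\<close>, since the gradient of a radial field controls
  \<open>norm (u x t) / norm x\<close>.
\<close>

definition regular_solution ::
    "real \<Rightarrow> (point \<Rightarrow> real \<Rightarrow> real) \<Rightarrow> (point \<Rightarrow> real \<Rightarrow> point) \<Rightarrow> (real \<Rightarrow> real) \<Rightarrow> bool" where
  "regular_solution T \<rho> u R \<longleftrightarrow>
     C1_on {0..T} R \<and>
     (\<forall>t\<in>{0..T}. continuous_on (cball 0 (R t)) (\<lambda>x. \<rho> x t)) \<and>
     C1_W1inf_on (punctured_tube T R) (\<lambda>(x, t). \<rho> x t) \<and>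
     C1_W1inf_on (punctured_tube T R) (\<lambda>(x, t). u x t)"

end

theory Submission
  imports Defs
begin

text \<open>
  A radial solution is labelled by the mass \<open>m\<close> enclosed by a sphere; the label of a fluid particle
  does not change in time and the total mass is conserved, so two solutions with the same data live
  on the same interval of labels. There the equations become \<open>r\<^sub>t = v\<close> and
  \<open>v\<^sub>t = - r\<^sup>2 p\<^sub>m\<close> with \<open>p = (r\<^sup>2 r\<^sub>m)\<close> to the power \<open>- \<gamma>\<close>, the Euler-Lagrange equations
  of a potential energy that is a convex function of \<open>(r, r\<^sub>m)\<close>. Since the velocity is Lipschitz,
  the ratios \<open>X\<close> of the radii and \<open>Y\<close> of their \<open>m\<close>-derivatives stay in a compact subset of
  \<open>(0, \<infinity>)\<close>, where the relative potential energy is comparable to \<open>(X - 1)\<^sup>2 + (Y - 1)\<^sup>2\<close> and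
  absorbs all error terms in the balance of the relative energy. The boundary flux is controlled by
  \<open>r\<^sup>2 p\<close>, which vanishes at the centre and at the vacuum boundary uniformly in time without any
  assumption on the decay of the density. A Gronwall argument then gives uniqueness.
\<close>

subsection \<open>Relative potential energy\<close>

text \<open>Nothing is known about the rate at which the density vanishes at the free boundary, nor
  about derivatives at the origin, so weighted norms or expansions near the ends of the label
  interval are out of reach; what survives is pointwise in the label. The logarithmic time
  derivatives of \<open>X\<close> and \<open>Y\<close> are differences of \<open>v / r\<close> and
  of \<open>\<beta>\<close>, the tangential and radial parts of the velocity gradient, so equal data
  confine both ratios to \<open>[1 / K, K]\<close> with \<open>K = exp (2 * C * T)\<close> for all
  labels at once. In the energy balance the pressure gradients, for which there is no bound, occur
  only inside an exact \<open>m\<close>-derivative. The remaining terms are of second order in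
  \<open>X - 1\<close> and \<open>Y - 1\<close> and carry the same weight
  \<open>\<rho>\<^sub>2 powr (\<gamma> - 1)\<close> as the potential energy, so the degeneracy of
  this weight at the vacuum is harmless. The flux stays small near the ends because
  \<open>r\<^sup>2 * p\<close> solves a linear homogeneous equation along each particle path: only
  its initial size matters. As the energy is not known to be integrable up to the ends, Gronwall is
  run on compact label intervals with the flux as an error.\<close>

lemma square_le_sub_ln:
  fixes x K :: real
  assumes "0 < x" "x \<le> K"
  shows "(x - 1)\<^sup>2 \<le> 2 * (K + 1) * (x - 1 - ln x)"
proof -
  \<comment> \<open>Passing to the root gains a square:
    \<open>ln x = 2 * ln s \<le> 2 * (s - 1)\<close> bounds \<open>x - 1 - ln x\<close> below by
    \<open>(s - 1)\<^sup>2\<close>, and the other factor in \<open>x - 1 = (s - 1) * (s + 1)\<close>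
    is controlled by \<open>K\<close>.\<close>
  define s where "s = sqrt x"
  have s: "s > 0" "x = s\<^sup>2" using assms by (auto simp: s_def)
  have "ln x = 2 * ln s" using s by (simp add: ln_realpow)
  also have "\<dots> \<le> 2 * (s - 1)" using s ln_le_minus_one[of s] by simp
  finally have 1: "(s - 1)\<^sup>2 \<le> x - 1 - ln x" using s by (simp add: power2_eq_square algebra_simps)
  have "(s + 1)\<^sup>2 \<le> 2 * (x + 1)"
    using s sum_squares_ge_zero[of "s - 1" 0] by (simp add: power2_eq_square algebra_simps)
  also have "\<dots> \<le> 2 * (K + 1)" using assms by simp
  finally have 2: "(s + 1)\<^sup>2 \<le> 2 * (K + 1)" .
  have "(x - 1)\<^sup>2 = (s + 1)\<^sup>2 * (s - 1)\<^sup>2" using s by (simp add: power2_eq_square algebra_simps)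
  also have "\<dots> \<le> 2 * (K + 1) * (x - 1 - ln x)"
    by (rule mult_mono) (use 1 2 assms in auto)
  finally show ?thesis .
qed

lemma abs_ln_le:
  fixes x K :: real
  assumes "1 / K \<le> x" "1 \<le> K"
  shows "\<bar>ln x\<bar> \<le> K * \<bar>x - 1\<bar>"
proof -
  have x: "0 < x" using assms by (smt (verit) divide_pos_pos)
  have "ln x \<le> x - 1" using x ln_le_minus_one by simp
  also have "\<dots> \<le> \<bar>x - 1\<bar>" by simp
  also have "\<dots> \<le> K * \<bar>x - 1\<bar>" using assms mult_right_mono[of 1 K "\<bar>x - 1\<bar>"] by simp
  finally have 1: "ln x \<le> K * \<bar>x - 1\<bar>" .
  have "- ln x \<le> 1 / x - 1" using x ln_le_minus_one[of "1 / x"] by (simp add: ln_div)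
  also have "\<dots> = (1 / x) * (1 - x)" using x by (simp add: field_simps)
  also have "\<dots> \<le> (1 / x) * \<bar>x - 1\<bar>" using x by (intro mult_left_mono) auto
  also have "\<dots> \<le> K * \<bar>x - 1\<bar>"
  proof (rule mult_right_mono)
    show "1 / x \<le> K" using x assms by (simp add: field_simps)
  qed simp
  finally show ?thesis using 1 by simp
qed

lemma abs_exp_sub_one_le: "\<bar>exp s - 1\<bar> \<le> \<bar>s\<bar> * exp \<bar>s\<bar>" for s :: real
proof (cases "s \<ge> 0")
  case True
  have "(1 - s) * exp s \<le> exp (- s) * exp s"
    using exp_ge_add_one_self[of "- s"] by (intro mult_right_mono) auto
  then have "exp s - 1 \<le> s * exp s" by (simp add: algebra_simps flip: exp_add)
  then show ?thesis using True by simp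
next
  case False
  have "exp s \<le> 1" "1 + s \<le> exp s" using False by auto
  moreover have "\<bar>s\<bar> \<le> \<bar>s\<bar> * exp \<bar>s\<bar>" using mult_left_mono[of 1 "exp \<bar>s\<bar>" "\<bar>s\<bar>"] by simp
  ultimately show ?thesis using False by linarith
qed

text \<open>The product is \<open>exp s\<close> with \<open>s\<close> linear in \<open>ln X\<close>
  and \<open>ln Y\<close>. On the compact range \<open>\<bar>s\<bar>\<close> is at most
  \<open>c * K\<close> times the distance to (1, 1), and at most \<open>2 * c * K\<^sup>2\<close>
  outright, which is the exponent in the constant.\<close>

lemma powr_powr_sub_one_le:
  fixes X Y K c p q :: real
  assumes K: "1 \<le> K" and X: "1 / K \<le> X" "X \<le> K" and Y: "1 / K \<le> Y" "Y \<le> K"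
    and p: "\<bar>p\<bar> \<le> c" and q: "\<bar>q\<bar> \<le> c"
  shows "\<bar>X powr p * Y powr q - 1\<bar> \<le> (c * K * exp (2 * c * K\<^sup>2)) * (\<bar>X - 1\<bar> + \<bar>Y - 1\<bar>)"
proof -
  have pos: "0 < X" "0 < Y" using K X Y by (smt (verit) divide_pos_pos)+
  define s where "s = p * ln X + q * ln Y"
  define a where "a = \<bar>X - 1\<bar> + \<bar>Y - 1\<bar>"
  have "c \<ge> 0" using p by simp
  have "\<bar>s\<bar> \<le> \<bar>p\<bar> * \<bar>ln X\<bar> + \<bar>q\<bar> * \<bar>ln Y\<bar>"
    unfolding s_def using abs_triangle_ineq[of "p * ln X" "q * ln Y"] by (simp only: abs_mult)
  also have "\<dots> \<le> c * (K * \<bar>X - 1\<bar>) + c * (K * \<bar>Y - 1\<bar>)"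
    by (intro add_mono[OF mult_mono[OF p abs_ln_le[OF X(1) K]] mult_mono[OF q abs_ln_le[OF Y(1) K]]]
        \<open>c \<ge> 0\<close> abs_ge_zero)
  finally have s: "\<bar>s\<bar> \<le> c * K * a" by (simp add: algebra_simps a_def)
  have "\<bar>X - 1\<bar> \<le> K" "\<bar>Y - 1\<bar> \<le> K" using X(2) Y(2) pos K by linarith+
  then have "c * K * a \<le> c * K * (2 * K)"
    unfolding a_def using \<open>c \<ge> 0\<close> K by (intro mult_left_mono) simp_all
  then have s2: "\<bar>s\<bar> \<le> 2 * c * K\<^sup>2" using s by (simp add: power2_eq_square)
  have "X powr p * Y powr q = exp s" using pos by (simp add: powr_def s_def exp_add)
  then have "\<bar>X powr p * Y powr q - 1\<bar> \<le> \<bar>s\<bar> * exp \<bar>s\<bar>" using abs_exp_sub_one_le by simp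
  also have "\<dots> \<le> (c * K * a) * exp (2 * c * K\<^sup>2)"
    using s s2 by (intro mult_mono) auto
  finally show ?thesis by (simp add: a_def mult_ac)
qed

text \<open>
  First-order Taylor remainder at \<open>(1, 1)\<close> of the potential energy \<open>(X\<^sup>2 Y)\<close> to the power \<open>1 - \<gamma>\<close>
  over \<open>\<gamma> - 1\<close>, where \<open>X\<close> and \<open>Y\<close> are the ratios of \<open>r\<close> and \<open>\<partial>r/\<partial>m\<close> for the two flows.
\<close>

definition relative_potential :: "real \<Rightarrow> real \<Rightarrow> real \<Rightarrow> real" where
  "relative_potential \<gamma> X Y =
     (X powr (2 * (1 - \<gamma>)) * Y powr (1 - \<gamma>) - 1) / (\<gamma> - 1) + 2 * (X - 1) + (Y - 1)"

text \<open>The tangent inequality \<open>s \<le> exp s - 1\<close>, where \<open>exp s\<close> is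
  the power term, replaces a Hessian computation: \<gamma> cancels, and the lower bound splits into
  a function of \<open>X\<close> and one of \<open>Y\<close>.\<close>

lemma relative_potential_ge:
  assumes "\<gamma> > 1" "0 < X" "0 < Y"
  shows "2 * (X - 1 - ln X) + (Y - 1 - ln Y) \<le> relative_potential \<gamma> X Y"
proof -
  define s where "s = 2 * (1 - \<gamma>) * ln X + (1 - \<gamma>) * ln Y"
  have "X powr (2 * (1 - \<gamma>)) * Y powr (1 - \<gamma>) = exp s"
    using assms by (simp add: powr_def s_def exp_add)
  moreover have "s \<le> exp s - 1" using exp_ge_add_one_self[of s] by linarith
  ultimately have "s / (\<gamma> - 1) \<le> (X powr (2 * (1 - \<gamma>)) * Y powr (1 - \<gamma>) - 1) / (\<gamma> - 1)"
    using assms by (intro divide_right_mono) auto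
  moreover have "s = (\<gamma> - 1) * (- 2 * ln X - ln Y)" by (simp add: s_def algebra_simps)
  then have "s / (\<gamma> - 1) = - 2 * ln X - ln Y" using assms by simp
  ultimately show ?thesis by (simp add: relative_potential_def)
qed

lemma relative_potential_coercive:
  assumes "\<gamma> > 1" "0 < X" "0 < Y" "X \<le> K" "Y \<le> K"
  shows "(X - 1)\<^sup>2 + (Y - 1)\<^sup>2 \<le> 2 * (K + 1) * relative_potential \<gamma> X Y"
proof -
  have lx: "0 \<le> X - 1 - ln X" using ln_le_minus_one[of X] assms by simp
  have "(X - 1)\<^sup>2 + (Y - 1)\<^sup>2 \<le> 2 * (K + 1) * (X - 1 - ln X) + 2 * (K + 1) * (Y - 1 - ln Y)"
    using assms by (intro add_mono square_le_sub_ln)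
  also have "\<dots> = 2 * (K + 1) * ((X - 1 - ln X) + (Y - 1 - ln Y))" by (simp add: algebra_simps)
  also have "\<dots> \<le> 2 * (K + 1) * relative_potential \<gamma> X Y"
    using relative_potential_ge[OF assms(1-3)] lx assms by (intro mult_left_mono) auto
  finally show ?thesis .
qed

lemma relative_potential_nonneg:
  assumes "\<gamma> > 1" "0 < X" "0 < Y"
  shows "0 \<le> relative_potential \<gamma> X Y"
  using relative_potential_ge[OF assms] ln_le_minus_one[of X] ln_le_minus_one[of Y] assms by simp

text \<open>The left side is what the energy balance leaves over. Its first summand stems from
  differentiating the weight \<open>\<rho>\<^sub>2 powr (\<gamma> - 1)\<close>; in the other two
  both factors in \<open>X\<close> and \<open>Y\<close> vanish at (1, 1). All are thus of second
  order, and coercivity applies.\<close>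

lemma relative_potential_remainder:
  fixes \<gamma> K C :: real
  assumes g: "\<gamma> > 1" and K: "1 \<le> K" and C: "0 \<le> C"
  obtains N where
    "\<And>X Y \<alpha> \<beta>. \<lbrakk>1 / K \<le> X; X \<le> K; 1 / K \<le> Y; Y \<le> K; \<bar>\<alpha>\<bar> \<le> C; \<bar>\<beta>\<bar> \<le> C\<rbrakk> \<Longrightarrow>
       - (\<gamma> - 1) * (2 * \<alpha> + \<beta>) * relative_potential \<gamma> X Y
       + 2 * \<alpha> * ((X - 1) * (X powr (2 * (1 - \<gamma>)) * Y powr (1 - \<gamma>) / X - 1))
       + \<beta> * ((Y - 1) * (X powr (2 * (1 - \<gamma>)) * Y powr (1 - \<gamma>) / Y - 1))
       \<le> N * relative_potential \<gamma> X Y"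
proof -
  \<comment> \<open>This dominates the absolute values of the exponents
    \<open>2 * (1 - \<gamma>) - 1\<close>, \<open>1 - \<gamma>\<close>,
    \<open>2 * (1 - \<gamma>)\<close> and \<open>- \<gamma>\<close> that occur in
    \<open>?Q / X\<close> and \<open>?Q / Y\<close>.\<close>
  define c where "c = 2 * \<gamma> - 1"
  define L where "L = c * K * exp (2 * c * K\<^sup>2)"
  define N where "N = (\<gamma> - 1) * (3 * C) + 3 * C * (2 * L * (2 * (K + 1)))"
  show ?thesis
  proof (rule that[of N])
    fix X Y \<alpha> \<beta> :: real
    assume X: "1 / K \<le> X" "X \<le> K" and Y: "1 / K \<le> Y" "Y \<le> K"
      and a: "\<bar>\<alpha>\<bar> \<le> C" and b: "\<bar>\<beta>\<bar> \<le> C"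
    let ?P = "relative_potential \<gamma> X Y"
    let ?Q = "X powr (2 * (1 - \<gamma>)) * Y powr (1 - \<gamma>)"
    have pos: "0 < X" "0 < Y" using K X Y by (smt (verit) divide_pos_pos)+
    have P: "0 \<le> ?P" using relative_potential_nonneg g pos by blast
    have L: "L \<ge> 0" using g K by (simp add: L_def c_def)
    have 1: "- (\<gamma> - 1) * (2 * \<alpha> + \<beta>) * ?P \<le> (\<gamma> - 1) * (3 * C) * ?P"
    proof (rule mult_right_mono[OF _ P])
      have "- (2 * \<alpha> + \<beta>) \<le> 3 * C" using a b by linarith
      then have "(\<gamma> - 1) * (- (2 * \<alpha> + \<beta>)) \<le> (\<gamma> - 1) * (3 * C)"
        using g by (intro mult_left_mono) auto
      then show "- (\<gamma> - 1) * (2 * \<alpha> + \<beta>) \<le> (\<gamma> - 1) * (3 * C)" by (simp add: algebra_simps)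
    qed
    have X': "?Q / X = X powr (2 * (1 - \<gamma>) - 1) * Y powr (1 - \<gamma>)"
      using pos by (subst powr_diff) simp_all
    have Y': "?Q / Y = X powr (2 * (1 - \<gamma>)) * Y powr (1 - \<gamma> - 1)"
      using pos by (subst (2) powr_diff) simp_all
    let ?a = "\<bar>X - 1\<bar>" and ?b = "\<bar>Y - 1\<bar>"
    have dX: "\<bar>?Q / X - 1\<bar> \<le> L * (?a + ?b)"
      unfolding X' L_def by (rule powr_powr_sub_one_le[OF K X Y]) (use g in \<open>auto simp: c_def\<close>)
    have dY: "\<bar>?Q / Y - 1\<bar> \<le> L * (?a + ?b)"
      unfolding Y' L_def by (rule powr_powr_sub_one_le[OF K X Y]) (use g in \<open>auto simp: c_def\<close>)
    have ab: "?a * (?a + ?b) \<le> 2 * (?a\<^sup>2 + ?b\<^sup>2)" "?b * (?a + ?b) \<le> 2 * (?a\<^sup>2 + ?b\<^sup>2)"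
      using sum_squares_bound[of ?a ?b] zero_le_power2[of ?a] zero_le_power2[of ?b]
      unfolding power2_eq_square distrib_left mult.commute[of ?b ?a] by linarith+
    have sq: "?a\<^sup>2 + ?b\<^sup>2 \<le> 2 * (K + 1) * ?P"
      using relative_potential_coercive[OF g pos X(2) Y(2)] by simp
    have q: "\<bar>d\<bar> * \<bar>e\<bar> \<le> 2 * L * (2 * (K + 1)) * ?P"
      if e: "\<bar>e\<bar> \<le> L * (?a + ?b)" and d: "\<bar>d\<bar> * (?a + ?b) \<le> 2 * (?a\<^sup>2 + ?b\<^sup>2)" for d e
    proof -
      have "\<bar>d\<bar> * \<bar>e\<bar> \<le> \<bar>d\<bar> * (L * (?a + ?b))" using e by (intro mult_left_mono) auto
      also have "\<dots> = L * (\<bar>d\<bar> * (?a + ?b))" by simp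
      also have "\<dots> \<le> L * (2 * (?a\<^sup>2 + ?b\<^sup>2))" using d L by (intro mult_left_mono)
      also have "\<dots> \<le> L * (2 * (2 * (K + 1) * ?P))" using sq L by (intro mult_left_mono) auto
      finally show ?thesis by (simp add: algebra_simps)
    qed
    have q': "z * (d * e) \<le> C * (2 * L * (2 * (K + 1)) * ?P)"
      if "\<bar>e\<bar> \<le> L * (?a + ?b)" "\<bar>d\<bar> * (?a + ?b) \<le> 2 * (?a\<^sup>2 + ?b\<^sup>2)" "\<bar>z\<bar> \<le> C" for z d e
    proof -
      have "z * (d * e) \<le> \<bar>z\<bar> * (\<bar>d\<bar> * \<bar>e\<bar>)" by (metis abs_ge_self abs_mult)
      also have "\<dots> \<le> C * (2 * L * (2 * (K + 1)) * ?P)"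
        by (rule mult_mono[OF that(3) q[OF that(1,2)] C]) simp
      finally show ?thesis .
    qed
    have 2: "\<alpha> * ((X - 1) * (?Q / X - 1)) \<le> C * (2 * L * (2 * (K + 1)) * ?P)"
      by (rule q'[OF dX ab(1) a])
    have 3: "\<beta> * ((Y - 1) * (?Q / Y - 1)) \<le> C * (2 * L * (2 * (K + 1)) * ?P)"
      by (rule q'[OF dY ab(2) b])
    have "N * ?P = (\<gamma> - 1) * (3 * C) * ?P + 3 * (C * (2 * L * (2 * (K + 1)) * ?P))"
      by (simp add: N_def algebra_simps)
    then show "- (\<gamma> - 1) * (2 * \<alpha> + \<beta>) * ?P + 2 * \<alpha> * ((X - 1) * (?Q / X - 1))
       + \<beta> * ((Y - 1) * (?Q / Y - 1)) \<le> N * ?P"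
      using 1 2 3 by linarith
  qed
qed

text \<open>Stated through logarithmic derivatives because the ratios of two flows solve linear
  homogeneous equations in time.\<close>

lemma has_real_derivative_relative_potential:
  assumes "(X has_real_derivative X t * \<xi>) (at t within S)"
    and "(Y has_real_derivative Y t * \<eta>) (at t within S)"
    and "X t > 0" "Y t > 0" "\<gamma> \<noteq> 1"
  shows "((\<lambda>t. relative_potential \<gamma> (X t) (Y t)) has_real_derivative
     - (X t powr (2 * (1 - \<gamma>)) * Y t powr (1 - \<gamma>)) * (2 * \<xi> + \<eta>) + 2 * X t * \<xi> + Y t * \<eta>)
     (at t within S)"
proof -
  have d: "((\<lambda>t. Z t powr a) has_real_derivative a * Z t powr a * \<zeta>) (at t within S)"
    if "(Z has_real_derivative Z t * \<zeta>) (at t within S)" "Z t > 0" for Z a \<zeta>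
  proof -
    have "((\<lambda>t. Z t powr a) has_real_derivative Z t powr a * (a * (Z t * \<zeta>) / Z t)) (at t within S)"
      by (rule derivative_eq_intros that refl)+ (use that in \<open>auto simp: field_simps powr_diff\<close>)
    then show ?thesis by (rule DERIV_cong) (use that in \<open>simp add: field_simps\<close>)
  qed
  define A where "A = (\<lambda>t. X t powr (2 * (1 - \<gamma>)))"
  define B where "B = (\<lambda>t. Y t powr (1 - \<gamma>))"
  have A: "(A has_real_derivative 2 * (1 - \<gamma>) * A t * \<xi>) (at t within S)"
    and B: "(B has_real_derivative (1 - \<gamma>) * B t * \<eta>) (at t within S)"
    unfolding A_def B_def using assms by (auto intro!: d)
  have g: "\<gamma> - 1 \<noteq> 0" using assms(5) by simp
  have "((\<lambda>t. (A t * B t - 1) / (\<gamma> - 1) + 2 * (X t - 1) + (Y t - 1)) has_real_derivative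
     - (A t * B t) * (2 * \<xi> + \<eta>) + 2 * X t * \<xi> + Y t * \<eta>) (at t within S)"
    by (rule DERIV_cong, (rule derivative_intros A B assms(1,2) g)+) (use g in \<open>simp add: divide_simps, algebra\<close>)
  then show ?thesis unfolding relative_potential_def A_def B_def .
qed

subsection \<open>Flows in the mass coordinate\<close>

lemma le_initial_value:
  fixes h :: "real \<Rightarrow> real"
  assumes "\<And>t. t \<in> {0..T} \<Longrightarrow> (h has_real_derivative h' t) (at t within {0..T})"
    and "\<And>t. t \<in> {0..T} \<Longrightarrow> h' t \<le> 0" and t: "t \<in> {0..T}"
  shows "h t \<le> h 0"
proof (rule DERIV_nonpos_imp_decreasing_open[where f = h])
  show "0 \<le> t" using t by simp
  show "\<exists>y. (h has_real_derivative y) (at x) \<and> y \<le> 0" if "0 < x" "x < t" for x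
    using assms(1,2)[of x] that t at_within_interior[of x "{0..T}"] by auto
  have "continuous_on {0..T} h" using assms(1) by (intro DERIV_continuous_on)
  then show "continuous_on {0..t} h" by (rule continuous_on_subset) (use t in auto)
qed

lemma exponential_growth_bound:
  fixes f :: "real \<Rightarrow> real"
  assumes "\<And>t. t \<in> {0..T} \<Longrightarrow> (f has_real_derivative f t * \<kappa> t) (at t within {0..T})"
    and "\<And>t. t \<in> {0..T} \<Longrightarrow> f t > 0" and "\<And>t. t \<in> {0..T} \<Longrightarrow> \<kappa> t \<le> c"
    and t: "t \<in> {0..T}"
  shows "f t \<le> f 0 * exp (c * t)"
proof -
  have "f t * exp (- c * t) \<le> f 0 * exp (- c * 0)"
  proof (rule le_initial_value[OF _ _ t, where h = "\<lambda>t. f t * exp (- c * t)"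
      and h' = "\<lambda>t. f t * (\<kappa> t - c) * exp (- c * t)"])
    fix s assume s: "s \<in> {0..T}"
    show "((\<lambda>t. f t * exp (- c * t)) has_real_derivative f s * (\<kappa> s - c) * exp (- c * s))
        (at s within {0..T})"
      by (rule derivative_eq_intros assms(1)[OF s] refl)+ (simp add: algebra_simps)
    show "f s * (\<kappa> s - c) * exp (- c * s) \<le> 0"
      using assms(2,3)[OF s] by (simp add: mult_le_0_iff)
  qed
  then show ?thesis by (simp add: exp_minus field_simps)
qed

text \<open>The lower bound is the upper one for \<open>inverse (f t)\<close>, which solves the same
  equation with \<open>- \<kappa>\<close>.\<close>

lemma exponential_two_sided_bound:
  fixes f :: "real \<Rightarrow> real"
  assumes "\<And>t. t \<in> {0..T} \<Longrightarrow> (f has_real_derivative f t * \<kappa> t) (at t within {0..T})"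
    and "\<And>t. t \<in> {0..T} \<Longrightarrow> f t > 0" and k: "\<And>t. t \<in> {0..T} \<Longrightarrow> \<bar>\<kappa> t\<bar> \<le> c"
    and "f 0 = 1" and t: "t \<in> {0..T}"
  shows "1 / exp (c * T) \<le> f t" "f t \<le> exp (c * T)"
proof -
  have ct: "exp (c * t) \<le> exp (c * T)" using k[OF t] t by (simp add: mult_left_mono)
  have "f t \<le> f 0 * exp (c * t)"
    by (rule exponential_growth_bound[OF assms(1,2) _ t]) (use k in \<open>auto simp: abs_le_iff\<close>)
  then show "f t \<le> exp (c * T)" using ct assms(4) by (simp del: exp_le_cancel_iff)
  have "inverse (f t) \<le> inverse (f 0) * exp (c * t)"
  proof (rule exponential_growth_bound[OF _ _ _ t, where f = "\<lambda>t. inverse (f t)" and \<kappa> = "\<lambda>t. - \<kappa> t"])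
    fix s assume s: "s \<in> {0..T}"
    show "((\<lambda>t. inverse (f t)) has_real_derivative inverse (f s) * - \<kappa> s) (at s within {0..T})"
      by (rule derivative_eq_intros assms(1)[OF s] refl)+
        (use assms(2)[OF s] in \<open>simp_all add: field_simps\<close>)
  qed (use assms(2) k in \<open>auto simp: abs_le_iff\<close>)
  then have "inverse (f t) \<le> exp (c * T)" using ct assms(4) by (simp del: exp_le_cancel_iff)
  then have "inverse (exp (c * T)) \<le> f t"
    using assms(2)[OF t] by (simp add: field_simps)
  then show "1 / exp (c * T) \<le> f t" by (simp add: inverse_eq_divide)
qed

text \<open>
  Motion in the mass coordinate \<open>m\<close>: position \<open>r\<close>, velocity \<open>v\<close>, density \<open>\<rho>\<close>, radial
  velocity gradient \<open>\<beta>\<close> and pressure gradient \<open>dp\<close> of the shell that encloses mass \<open>m\<close>.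
\<close>

locale lagrangian_flow =
  fixes \<gamma> T M C :: real and r v \<rho> \<beta> dp :: "real \<Rightarrow> real \<Rightarrow> real"
  assumes \<gamma>: "\<gamma> > 1"
    and r_pos: "\<And>m t. m \<in> {0<..<M} \<Longrightarrow> t \<in> {0..T} \<Longrightarrow> r m t > 0"
    and \<rho>_pos: "\<And>m t. m \<in> {0<..<M} \<Longrightarrow> t \<in> {0..T} \<Longrightarrow> \<rho> m t > 0"
    and v_bound: "\<And>m t. m \<in> {0<..<M} \<Longrightarrow> t \<in> {0..T} \<Longrightarrow> \<bar>v m t\<bar> \<le> C"
    and v_le_r: "\<And>m t. m \<in> {0<..<M} \<Longrightarrow> t \<in> {0..T} \<Longrightarrow> \<bar>v m t / r m t\<bar> \<le> C"
    and \<beta>_bound: "\<And>m t. m \<in> {0<..<M} \<Longrightarrow> t \<in> {0..T} \<Longrightarrow> \<bar>\<beta> m t\<bar> \<le> C"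
    and r_t: "\<And>m t. m \<in> {0<..<M} \<Longrightarrow> t \<in> {0..T} \<Longrightarrow>
        ((\<lambda>t. r m t) has_real_derivative v m t) (at t within {0..T})"
    and v_t: "\<And>m t. m \<in> {0<..<M} \<Longrightarrow> t \<in> {0..T} \<Longrightarrow>
        ((\<lambda>t. v m t) has_real_derivative - ((r m t)\<^sup>2 * dp m t)) (at t within {0..T})"
    and \<rho>_t: "\<And>m t. m \<in> {0<..<M} \<Longrightarrow> t \<in> {0..T} \<Longrightarrow>
        ((\<lambda>t. \<rho> m t) has_real_derivative - \<rho> m t * (\<beta> m t + 2 * (v m t / r m t))) (at t within {0..T})"
    and r_m: "\<And>m t. m \<in> {0<..<M} \<Longrightarrow> t \<in> {0..T} \<Longrightarrow>
        ((\<lambda>m. r m t) has_real_derivative 1 / ((r m t)\<^sup>2 * \<rho> m t)) (at m)"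
    and v_m: "\<And>m t. m \<in> {0<..<M} \<Longrightarrow> t \<in> {0..T} \<Longrightarrow>
        ((\<lambda>m. v m t) has_real_derivative \<beta> m t / ((r m t)\<^sup>2 * \<rho> m t)) (at m)"
    and p_m: "\<And>m t. m \<in> {0<..<M} \<Longrightarrow> t \<in> {0..T} \<Longrightarrow>
        ((\<lambda>m. \<rho> m t powr \<gamma>) has_real_derivative dp m t) (at m)"
    and cont_r: "continuous_on ({0<..<M} \<times> {0..T}) (\<lambda>z. r (fst z) (snd z))"
    and cont_v: "continuous_on ({0<..<M} \<times> {0..T}) (\<lambda>z. v (fst z) (snd z))"
    and cont_\<rho>: "continuous_on ({0<..<M} \<times> {0..T}) (\<lambda>z. \<rho> (fst z) (snd z))"
    and cont_\<beta>: "continuous_on ({0<..<M} \<times> {0..T}) (\<lambda>z. \<beta> (fst z) (snd z))"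
    and cont_dp: "continuous_on ({0<..<M} \<times> {0..T}) (\<lambda>z. dp (fst z) (snd z))"
    and initial_flux_0: "((\<lambda>m. (r m 0)\<^sup>2 * \<rho> m 0 powr \<gamma>) \<longlongrightarrow> 0) (at_right 0)"
    and initial_flux_M: "((\<lambda>m. (r m 0)\<^sup>2 * \<rho> m 0 powr \<gamma>) \<longlongrightarrow> 0) (at_left M)"
begin

text \<open>Along a particle path \<open>r\<^sup>2 * p\<close> has logarithmic derivative
  \<open>?\<kappa>\<close>, which involves only \<open>v / r\<close> and \<open>\<beta>\<close>. The
  constant comes from \<open>\<bar>v / r\<bar> \<le> C\<close> and
  \<open>\<bar>\<beta> + 2 * (v / r)\<bar> \<le> 3 * C\<close>. Decay at the ends of the label
  interval is thereby inherited from time 0, uniformly in time.\<close>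

lemma flux_le_initial:
  assumes m: "m \<in> {0<..<M}" and t: "t \<in> {0..T}"
  shows "(r m t)\<^sup>2 * \<rho> m t powr \<gamma> \<le> (r m 0)\<^sup>2 * \<rho> m 0 powr \<gamma> * exp ((2 + 3 * \<gamma>) * C * T)"
proof -
  have C: "C \<ge> 0" using v_bound[OF m t] by simp
  let ?\<kappa> = "\<lambda>t. 2 * (v m t / r m t) - \<gamma> * (\<beta> m t + 2 * (v m t / r m t))"
  have "(r m t)\<^sup>2 * \<rho> m t powr \<gamma> \<le> (r m 0)\<^sup>2 * \<rho> m 0 powr \<gamma> * exp ((2 + 3 * \<gamma>) * C * t)"
  proof (rule exponential_growth_bound[OF _ _ _ t, where \<kappa> = ?\<kappa>])
    fix s assume s: "s \<in> {0..T}"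
    note pos = r_pos[OF m s] \<rho>_pos[OF m s]
    have "((\<lambda>t. (r m t)\<^sup>2 * \<rho> m t powr \<gamma>) has_real_derivative
        (r m s)\<^sup>2 * (\<rho> m s powr \<gamma> * (\<gamma> * (- \<rho> m s * (\<beta> m s + 2 * (v m s / r m s))) / \<rho> m s))
        + 2 * r m s * v m s * \<rho> m s powr \<gamma>) (at s within {0..T})"
      by (rule derivative_eq_intros r_t[OF m s] \<rho>_t[OF m s] refl pos)+ (use pos in \<open>simp add: powr_diff\<close>)
    then show "((\<lambda>t. (r m t)\<^sup>2 * \<rho> m t powr \<gamma>) has_real_derivative
        (r m s)\<^sup>2 * \<rho> m s powr \<gamma> * ?\<kappa> s) (at s within {0..T})"
      by (rule DERIV_cong) (use pos in \<open>simp add: field_simps power2_eq_square\<close>)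
    show "0 < (r m s)\<^sup>2 * \<rho> m s powr \<gamma>" using pos by simp
    have "- (\<beta> m s + 2 * (v m s / r m s)) \<le> 3 * C"
      using v_le_r[OF m s] \<beta>_bound[OF m s] by linarith
    then have "\<gamma> * - (\<beta> m s + 2 * (v m s / r m s)) \<le> \<gamma> * (3 * C)"
      using \<gamma> by (intro mult_left_mono) auto
    then show "?\<kappa> s \<le> (2 + 3 * \<gamma>) * C"
      using v_le_r[OF m s] unfolding distrib_right mult_minus_right by linarith
  qed
  also have "\<dots> \<le> (r m 0)\<^sup>2 * \<rho> m 0 powr \<gamma> * exp ((2 + 3 * \<gamma>) * C * T)"
    using C \<gamma> t by (intro mult_left_mono) (auto intro!: mult_left_mono)
  finally show ?thesis .
qed

end

text \<open>To be read with \<open>S = \<rho>\<^sub>2 powr (\<gamma> - 1)\<close>,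
  \<open>S * Q = \<rho>\<^sub>1 powr (\<gamma> - 1)\<close>, \<open>g = \<gamma> - 1\<close> and
  \<open>\<phi>\<close> the relative potential; then \<open>p\<^sub>1\<close>,
  \<open>p\<^sub>2\<close> are the pressures and \<open>b\<^sub>1\<close>, \<open>b\<^sub>2\<close>
  the label derivatives of the radii. With all powers abstracted into free variables, an identity of
  rational functions remains. The negated group on the right is the label derivative of the energy
  flux.\<close>

lemma energy_balance_identity:
  fixes r\<^sub>1 r\<^sub>2 \<rho>\<^sub>1 \<rho>\<^sub>2 v\<^sub>1 v\<^sub>2 \<beta>\<^sub>1 \<beta>\<^sub>2 d\<^sub>1 d\<^sub>2 g S Q \<phi> :: real
  assumes "r\<^sub>1 \<noteq> 0" "r\<^sub>2 \<noteq> 0" "\<rho>\<^sub>1 \<noteq> 0" "\<rho>\<^sub>2 \<noteq> 0"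
  defines "X \<equiv> r\<^sub>1 / r\<^sub>2" and "Y \<equiv> (r\<^sub>2\<^sup>2 * \<rho>\<^sub>2) / (r\<^sub>1\<^sup>2 * \<rho>\<^sub>1)"
    and "\<alpha>\<^sub>1 \<equiv> v\<^sub>1 / r\<^sub>1" and "\<alpha>\<^sub>2 \<equiv> v\<^sub>2 / r\<^sub>2"
    and "p\<^sub>1 \<equiv> \<rho>\<^sub>1 * (S * Q)" and "p\<^sub>2 \<equiv> \<rho>\<^sub>2 * S"
    and "b\<^sub>1 \<equiv> 1 / (r\<^sub>1\<^sup>2 * \<rho>\<^sub>1)" and "b\<^sub>2 \<equiv> 1 / (r\<^sub>2\<^sup>2 * \<rho>\<^sub>2)"
  shows "(v\<^sub>1 - v\<^sub>2) * (- (r\<^sub>1\<^sup>2 * d\<^sub>1) + r\<^sub>2\<^sup>2 * d\<^sub>2)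
      + (S * (- g * (\<beta>\<^sub>2 + 2 * \<alpha>\<^sub>2)) * \<phi>
        + S * (- Q * (2 * (\<alpha>\<^sub>1 - \<alpha>\<^sub>2) + (\<beta>\<^sub>1 - \<beta>\<^sub>2)) + 2 * X * (\<alpha>\<^sub>1 - \<alpha>\<^sub>2) + Y * (\<beta>\<^sub>1 - \<beta>\<^sub>2)))
    = - ((\<beta>\<^sub>1 * b\<^sub>1 - \<beta>\<^sub>2 * b\<^sub>2) * (r\<^sub>1\<^sup>2 * p\<^sub>1 - r\<^sub>2\<^sup>2 * p\<^sub>2)
        + (v\<^sub>1 - v\<^sub>2) * (2 * r\<^sub>1 * b\<^sub>1 * p\<^sub>1 + r\<^sub>1\<^sup>2 * d\<^sub>1 - (2 * r\<^sub>2 * b\<^sub>2 * p\<^sub>2 + r\<^sub>2\<^sup>2 * d\<^sub>2)))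
      + S * (- g * (2 * \<alpha>\<^sub>2 + \<beta>\<^sub>2) * \<phi> + 2 * \<alpha>\<^sub>2 * ((X - 1) * (Q / X - 1)) + \<beta>\<^sub>2 * ((Y - 1) * (Q / Y - 1)))"
  (is "?L = - ?F + ?R")
proof -
  \<comment> \<open>Every product of a pressure with a label derivative is expressed by
    \<open>S\<close>, \<open>Q\<close>, \<open>X\<close> and \<open>Y\<close>; afterwards radii and
    densities survive only in the pressure-gradient terms.\<close>
  have 1: "r\<^sub>1\<^sup>2 * b\<^sub>1 * p\<^sub>1 = S * Q" "r\<^sub>2\<^sup>2 * b\<^sub>2 * p\<^sub>2 = S" "r\<^sub>2\<^sup>2 * b\<^sub>1 * p\<^sub>2 = S * Y" "Y * (r\<^sub>1\<^sup>2 * b\<^sub>2 * p\<^sub>1) = S * Q"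
    "Y \<noteq> 0" "X \<noteq> 0" "\<And>v. (v * (2 * r\<^sub>1 * b\<^sub>1 * p\<^sub>1)) = 2 * S * Q * (v / r\<^sub>1)"
    "\<And>v. (v * (2 * r\<^sub>2 * b\<^sub>2 * p\<^sub>2)) = 2 * S * (v / r\<^sub>2)"
    "v\<^sub>1 / r\<^sub>2 = \<alpha>\<^sub>1 * X" "v\<^sub>2 / r\<^sub>1 = \<alpha>\<^sub>2 / X"
    using assms(1-4) by (simp_all add: p\<^sub>1_def p\<^sub>2_def b\<^sub>1_def b\<^sub>2_def X_def Y_def \<alpha>\<^sub>1_def \<alpha>\<^sub>2_def field_simps power2_eq_square)
  have "r\<^sub>1\<^sup>2 * b\<^sub>2 * p\<^sub>1 = S * Q / Y" using 1(4,5) by (simp add: field_simps)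
  note 2 = 1(1-3) this
  have "(\<beta>\<^sub>1 * b\<^sub>1 - \<beta>\<^sub>2 * b\<^sub>2) * (r\<^sub>1\<^sup>2 * p\<^sub>1 - r\<^sub>2\<^sup>2 * p\<^sub>2)
      = \<beta>\<^sub>1 * (r\<^sub>1\<^sup>2 * b\<^sub>1 * p\<^sub>1) - \<beta>\<^sub>1 * (r\<^sub>2\<^sup>2 * b\<^sub>1 * p\<^sub>2) - \<beta>\<^sub>2 * (r\<^sub>1\<^sup>2 * b\<^sub>2 * p\<^sub>1) + \<beta>\<^sub>2 * (r\<^sub>2\<^sup>2 * b\<^sub>2 * p\<^sub>2)"
    by (simp add: algebra_simps)
  also have "\<dots> = \<beta>\<^sub>1 * (S * Q) - \<beta>\<^sub>1 * (S * Y) - \<beta>\<^sub>2 * (S * Q / Y) + \<beta>\<^sub>2 * S" unfolding 2 ..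
  finally have 3: "(\<beta>\<^sub>1 * b\<^sub>1 - \<beta>\<^sub>2 * b\<^sub>2) * (r\<^sub>1\<^sup>2 * p\<^sub>1 - r\<^sub>2\<^sup>2 * p\<^sub>2) = \<dots>" .
  have "(v\<^sub>1 - v\<^sub>2) * (2 * r\<^sub>1 * b\<^sub>1 * p\<^sub>1 + r\<^sub>1\<^sup>2 * d\<^sub>1 - (2 * r\<^sub>2 * b\<^sub>2 * p\<^sub>2 + r\<^sub>2\<^sup>2 * d\<^sub>2))
     = v\<^sub>1 * (2 * r\<^sub>1 * b\<^sub>1 * p\<^sub>1) - v\<^sub>2 * (2 * r\<^sub>1 * b\<^sub>1 * p\<^sub>1) - v\<^sub>1 * (2 * r\<^sub>2 * b\<^sub>2 * p\<^sub>2) + v\<^sub>2 * (2 * r\<^sub>2 * b\<^sub>2 * p\<^sub>2)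
       + (v\<^sub>1 - v\<^sub>2) * (r\<^sub>1\<^sup>2 * d\<^sub>1 - r\<^sub>2\<^sup>2 * d\<^sub>2)"
    by (simp only: left_diff_distrib right_diff_distrib distrib_left distrib_right)
  also have "\<dots> = 2 * S * Q * \<alpha>\<^sub>1 - 2 * S * Q * (\<alpha>\<^sub>2 / X) - 2 * S * (\<alpha>\<^sub>1 * X) + 2 * S * \<alpha>\<^sub>2
       + (v\<^sub>1 - v\<^sub>2) * (r\<^sub>1\<^sup>2 * d\<^sub>1 - r\<^sub>2\<^sup>2 * d\<^sub>2)"
    unfolding 1(7-10) \<alpha>\<^sub>1_def[symmetric] \<alpha>\<^sub>2_def[symmetric] ..
  finally have 4: "(v\<^sub>1 - v\<^sub>2) * (2 * r\<^sub>1 * b\<^sub>1 * p\<^sub>1 + r\<^sub>1\<^sup>2 * d\<^sub>1 - (2 * r\<^sub>2 * b\<^sub>2 * p\<^sub>2 + r\<^sub>2\<^sup>2 * d\<^sub>2)) = \<dots>" .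
  have 5: "(X - 1) * (Q / X - 1) = Q - X - Q / X + 1" "(Y - 1) * (Q / Y - 1) = Q - Y - Q / Y + 1"
    using 1(5,6) by (simp_all add: field_simps)
  have 6: "S * Q / Y = S * (Q / Y)" "2 * S * Q * (\<alpha>\<^sub>2 / X) = 2 * S * \<alpha>\<^sub>2 * (Q / X)" by simp_all
  show ?thesis unfolding 3 4 5 6 by algebra
qed

section \<open>Relative energy of two flows with the same data\<close>

locale lagrangian_flow_pair =
  F1: lagrangian_flow \<gamma> T M C r\<^sub>1 v\<^sub>1 \<rho>\<^sub>1 \<beta>\<^sub>1 dp\<^sub>1 +
  F2: lagrangian_flow \<gamma> T M C r\<^sub>2 v\<^sub>2 \<rho>\<^sub>2 \<beta>\<^sub>2 dp\<^sub>2
  for \<gamma> T M C r\<^sub>1 v\<^sub>1 \<rho>\<^sub>1 \<beta>\<^sub>1 dp\<^sub>1 r\<^sub>2 v\<^sub>2 \<rho>\<^sub>2 \<beta>\<^sub>2 dp\<^sub>2 +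
  assumes r_initial: "\<And>m. m \<in> {0<..<M} \<Longrightarrow> r\<^sub>1 m 0 = r\<^sub>2 m 0"
    and v_initial: "\<And>m. m \<in> {0<..<M} \<Longrightarrow> v\<^sub>1 m 0 = v\<^sub>2 m 0"
    and \<rho>_initial: "\<And>m. m \<in> {0<..<M} \<Longrightarrow> \<rho>\<^sub>1 m 0 = \<rho>\<^sub>2 m 0"
begin

definition X :: "real \<Rightarrow> real \<Rightarrow> real" where
  "X m t = r\<^sub>1 m t / r\<^sub>2 m t"

text \<open>By \<open>r_m\<close> this is the label derivative of \<open>r\<^sub>1\<close> over that
  of \<open>r\<^sub>2\<close>; in this form it can be differentiated in time with the equations for
  \<open>r\<close> and \<open>\<rho>\<close> alone.\<close>

definition Y :: "real \<Rightarrow> real \<Rightarrow> real" where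
  "Y m t = ((r\<^sub>2 m t)\<^sup>2 * \<rho>\<^sub>2 m t) / ((r\<^sub>1 m t)\<^sup>2 * \<rho>\<^sub>1 m t)"

text \<open>Since \<open>(X m t)\<^sup>2 * Y m t = \<rho>\<^sub>2 m t / \<rho>\<^sub>1 m t\<close>,
  the second summand is the difference of the internal energies
  \<open>\<rho> powr (\<gamma> - 1) / (\<gamma> - 1)\<close> per unit mass, minus its first-order
  part at the second flow.\<close>

definition energy :: "real \<Rightarrow> real \<Rightarrow> real" where
  "energy m t = (v\<^sub>1 m t - v\<^sub>2 m t)\<^sup>2 / 2 + \<rho>\<^sub>2 m t powr (\<gamma> - 1) * relative_potential \<gamma> (X m t) (Y m t)"

definition energy_t :: "real \<Rightarrow> real \<Rightarrow> real" where
  "energy_t m t = (v\<^sub>1 m t - v\<^sub>2 m t) * (- ((r\<^sub>1 m t)\<^sup>2 * dp\<^sub>1 m t) + (r\<^sub>2 m t)\<^sup>2 * dp\<^sub>2 m t)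
      + (\<rho>\<^sub>2 m t powr (\<gamma> - 1) * (- (\<gamma> - 1) * (\<beta>\<^sub>2 m t + 2 * (v\<^sub>2 m t / r\<^sub>2 m t)))
           * relative_potential \<gamma> (X m t) (Y m t)
        + \<rho>\<^sub>2 m t powr (\<gamma> - 1) * (- (X m t powr (2 * (1 - \<gamma>)) * Y m t powr (1 - \<gamma>))
              * (2 * (v\<^sub>1 m t / r\<^sub>1 m t - v\<^sub>2 m t / r\<^sub>2 m t) + (\<beta>\<^sub>1 m t - \<beta>\<^sub>2 m t))
            + 2 * X m t * (v\<^sub>1 m t / r\<^sub>1 m t - v\<^sub>2 m t / r\<^sub>2 m t) + Y m t * (\<beta>\<^sub>1 m t - \<beta>\<^sub>2 m t)))"

definition flux :: "real \<Rightarrow> real \<Rightarrow> real" where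
  "flux m t = (v\<^sub>1 m t - v\<^sub>2 m t) * ((r\<^sub>1 m t)\<^sup>2 * \<rho>\<^sub>1 m t powr \<gamma> - (r\<^sub>2 m t)\<^sup>2 * \<rho>\<^sub>2 m t powr \<gamma>)"

definition flux_m :: "real \<Rightarrow> real \<Rightarrow> real" where
  "flux_m m t = (\<beta>\<^sub>1 m t * (1 / ((r\<^sub>1 m t)\<^sup>2 * \<rho>\<^sub>1 m t)) - \<beta>\<^sub>2 m t * (1 / ((r\<^sub>2 m t)\<^sup>2 * \<rho>\<^sub>2 m t)))
        * ((r\<^sub>1 m t)\<^sup>2 * \<rho>\<^sub>1 m t powr \<gamma> - (r\<^sub>2 m t)\<^sup>2 * \<rho>\<^sub>2 m t powr \<gamma>)
      + (v\<^sub>1 m t - v\<^sub>2 m t)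
        * (2 * r\<^sub>1 m t * (1 / ((r\<^sub>1 m t)\<^sup>2 * \<rho>\<^sub>1 m t)) * \<rho>\<^sub>1 m t powr \<gamma> + (r\<^sub>1 m t)\<^sup>2 * dp\<^sub>1 m t
          - (2 * r\<^sub>2 m t * (1 / ((r\<^sub>2 m t)\<^sup>2 * \<rho>\<^sub>2 m t)) * \<rho>\<^sub>2 m t powr \<gamma> + (r\<^sub>2 m t)\<^sup>2 * dp\<^sub>2 m t))"

context
  fixes m t :: real
  assumes m: "m \<in> {0<..<M}" and t: "t \<in> {0..T}"
begin

lemma positive: "r\<^sub>1 m t > 0" "r\<^sub>2 m t > 0" "\<rho>\<^sub>1 m t > 0" "\<rho>\<^sub>2 m t > 0" "X m t > 0" "Y m t > 0"
  using F1.r_pos[OF m t] F2.r_pos[OF m t] F1.\<rho>_pos[OF m t] F2.\<rho>_pos[OF m t]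
  by (auto simp: X_def Y_def)

lemma energy_nonneg: "energy m t \<ge> 0"
  unfolding energy_def using positive relative_potential_nonneg[OF F1.\<gamma>] by simp

lemma X_t: "((\<lambda>t. X m t) has_real_derivative X m t * (v\<^sub>1 m t / r\<^sub>1 m t - v\<^sub>2 m t / r\<^sub>2 m t))
    (at t within {0..T})"
proof -
  have "((\<lambda>t. r\<^sub>1 m t / r\<^sub>2 m t) has_real_derivative
      (v\<^sub>1 m t * r\<^sub>2 m t - r\<^sub>1 m t * v\<^sub>2 m t) / (r\<^sub>2 m t * r\<^sub>2 m t)) (at t within {0..T})"
    by (rule derivative_intros F1.r_t[OF m t] F2.r_t[OF m t])+ (use positive in simp)
  then show ?thesis
    unfolding X_def by (rule DERIV_cong) (use positive in \<open>simp add: field_simps\<close>)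
qed

text \<open>The terms \<open>2 * (v / r)\<close> coming from the squared radius and from the density
  cancel, so \<open>r\<^sup>2 * \<rho>\<close> has logarithmic derivative
  \<open>- \<beta>\<close>.\<close>

lemma Y_t: "((\<lambda>t. Y m t) has_real_derivative Y m t * (\<beta>\<^sub>1 m t - \<beta>\<^sub>2 m t)) (at t within {0..T})"
proof -
  have d: "((\<lambda>t. (r m t)\<^sup>2 * \<rho> m t) has_real_derivative - ((r m t)\<^sup>2 * \<rho> m t * \<beta> m t)) (at t within {0..T})"
    if "lagrangian_flow \<gamma> T M C r v \<rho> \<beta> dp" for r v \<rho> \<beta> dp
  proof -
    interpret lagrangian_flow \<gamma> T M C r v \<rho> \<beta> dp by (rule that)
    show ?thesis
      by (rule derivative_eq_intros r_t[OF m t] \<rho>_t[OF m t] refl)+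
        (use r_pos[OF m t] in \<open>simp add: field_simps power2_eq_square\<close>)
  qed
  note d1 = d[OF F1.lagrangian_flow_axioms] and d2 = d[OF F2.lagrangian_flow_axioms]
  define A B where "A = (\<lambda>t. (r\<^sub>2 m t)\<^sup>2 * \<rho>\<^sub>2 m t)" and "B = (\<lambda>t. (r\<^sub>1 m t)\<^sup>2 * \<rho>\<^sub>1 m t)"
  have dA: "(A has_real_derivative - (A t * \<beta>\<^sub>2 m t)) (at t within {0..T})"
    and dB: "(B has_real_derivative - (B t * \<beta>\<^sub>1 m t)) (at t within {0..T})"
    using d1 d2 by (simp_all add: A_def B_def)
  have B: "B t \<noteq> 0" using positive by (simp add: B_def)
  have "((\<lambda>t. A t / B t) has_real_derivative
      (- (A t * \<beta>\<^sub>2 m t) * B t - A t * - (B t * \<beta>\<^sub>1 m t)) / (B t * B t)) (at t within {0..T})"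
    by (rule derivative_intros dA dB B)+
  then have "((\<lambda>t. A t / B t) has_real_derivative A t / B t * (\<beta>\<^sub>1 m t - \<beta>\<^sub>2 m t)) (at t within {0..T})"
    by (rule DERIV_cong) (use B in \<open>simp add: field_simps\<close>)
  then show ?thesis by (simp add: Y_def A_def B_def)
qed

lemma energy_has_derivative: "((\<lambda>t. energy m t) has_real_derivative energy_t m t) (at t within {0..T})"
proof -
  have S: "((\<lambda>t. \<rho>\<^sub>2 m t powr (\<gamma> - 1)) has_real_derivative
      \<rho>\<^sub>2 m t powr (\<gamma> - 1) * (- (\<gamma> - 1) * (\<beta>\<^sub>2 m t + 2 * (v\<^sub>2 m t / r\<^sub>2 m t)))) (at t within {0..T})"
    by (rule derivative_eq_intros F2.\<rho>_t[OF m t] positive(4) refl)+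
      (use positive in \<open>simp_all add: powr_diff field_simps power2_eq_square\<close>)
  have P: "((\<lambda>t. relative_potential \<gamma> (X m t) (Y m t)) has_real_derivative
     - (X m t powr (2 * (1 - \<gamma>)) * Y m t powr (1 - \<gamma>))
        * (2 * (v\<^sub>1 m t / r\<^sub>1 m t - v\<^sub>2 m t / r\<^sub>2 m t) + (\<beta>\<^sub>1 m t - \<beta>\<^sub>2 m t))
      + 2 * X m t * (v\<^sub>1 m t / r\<^sub>1 m t - v\<^sub>2 m t / r\<^sub>2 m t) + Y m t * (\<beta>\<^sub>1 m t - \<beta>\<^sub>2 m t)) (at t within {0..T})"
    by (rule has_real_derivative_relative_potential[OF X_t Y_t]) (use positive F1.\<gamma> in auto)
  have V: "((\<lambda>t. (v\<^sub>1 m t - v\<^sub>2 m t)\<^sup>2 / 2) has_real_derivative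
      (v\<^sub>1 m t - v\<^sub>2 m t) * (- ((r\<^sub>1 m t)\<^sup>2 * dp\<^sub>1 m t) + (r\<^sub>2 m t)\<^sup>2 * dp\<^sub>2 m t)) (at t within {0..T})"
    by (auto intro!: derivative_eq_intros F1.v_t[OF m t] F2.v_t[OF m t])
  show ?thesis
    unfolding energy_def energy_t_def
    by (rule DERIV_cong[OF DERIV_add[OF V DERIV_mult[OF S P]]]) (simp add: algebra_simps)
qed

lemma flux_has_derivative: "((\<lambda>m. flux m t) has_real_derivative flux_m m t) (at m)"
  unfolding flux_def flux_m_def
  by (rule derivative_eq_intros F1.v_m[OF m t] F2.v_m[OF m t] F1.r_m[OF m t] F2.r_m[OF m t]
      F1.p_m[OF m t] F2.p_m[OF m t] refl)+ (simp add: algebra_simps)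

text \<open>Here \<open>dp\<^sub>1\<close> and \<open>dp\<^sub>2\<close> disappear into an exact
  label derivative, which integrates to boundary values. The rest has the form estimated by
  \<open>relative_potential_remainder\<close>, multiplied by the weight.\<close>

lemma energy_t_eq:
  defines "Q \<equiv> X m t powr (2 * (1 - \<gamma>)) * Y m t powr (1 - \<gamma>)" and "\<alpha> \<equiv> v\<^sub>2 m t / r\<^sub>2 m t"
  shows "energy_t m t = - flux_m m t + \<rho>\<^sub>2 m t powr (\<gamma> - 1) *
    (- (\<gamma> - 1) * (2 * \<alpha> + \<beta>\<^sub>2 m t) * relative_potential \<gamma> (X m t) (Y m t)
      + 2 * \<alpha> * ((X m t - 1) * (Q / X m t - 1)) + \<beta>\<^sub>2 m t * ((Y m t - 1) * (Q / Y m t - 1)))"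
proof -
  note pos = positive
  have "X m t powr (2 * (1 - \<gamma>)) = ((X m t)\<^sup>2) powr (1 - \<gamma>)"
    using pos by (simp add: powr_powr flip: powr_numeral)
  then have "Q = ((X m t)\<^sup>2 * Y m t) powr (1 - \<gamma>)"
    using pos by (simp add: Q_def powr_mult)
  also have "(X m t)\<^sup>2 * Y m t = \<rho>\<^sub>2 m t / \<rho>\<^sub>1 m t"
    using pos by (simp add: X_def Y_def field_simps)
  also have "\<dots> powr (1 - \<gamma>) = \<rho>\<^sub>1 m t powr (\<gamma> - 1) / \<rho>\<^sub>2 m t powr (\<gamma> - 1)"
    using pos by (simp add: powr_divide powr_diff field_simps)
  finally have "\<rho>\<^sub>1 m t powr (\<gamma> - 1) = \<rho>\<^sub>2 m t powr (\<gamma> - 1) * Q" using pos by simp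
  then have 1: "\<rho>\<^sub>1 m t powr \<gamma> = \<rho>\<^sub>1 m t * (\<rho>\<^sub>2 m t powr (\<gamma> - 1) * Q)"
    using pos powr_mult_base[of "\<rho>\<^sub>1 m t" "\<gamma> - 1"] by simp
  have 2: "\<rho>\<^sub>2 m t powr \<gamma> = \<rho>\<^sub>2 m t * \<rho>\<^sub>2 m t powr (\<gamma> - 1)"
    using pos powr_mult_base[of "\<rho>\<^sub>2 m t" "\<gamma> - 1"] by simp
  show ?thesis
    unfolding energy_t_def flux_m_def 1 2 Q_def[symmetric] \<alpha>_def unfolding X_def Y_def
    by (rule energy_balance_identity) (use pos in auto)
qed

text \<open>\<open>flux_le_initial\<close> leaves a bound without \<open>t\<close>, so the flux is
  small near the ends at all times simultaneously.\<close>

lemma abs_flux_le: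
  "\<bar>flux m t\<bar> \<le> 2 * C * (((r\<^sub>1 m 0)\<^sup>2 * \<rho>\<^sub>1 m 0 powr \<gamma> + (r\<^sub>2 m 0)\<^sup>2 * \<rho>\<^sub>2 m 0 powr \<gamma>)
     * exp ((2 + 3 * \<gamma>) * C * T))"
proof -
  let ?p1 = "(r\<^sub>1 m t)\<^sup>2 * \<rho>\<^sub>1 m t powr \<gamma>" and ?p2 = "(r\<^sub>2 m t)\<^sup>2 * \<rho>\<^sub>2 m t powr \<gamma>"
  have nn: "?p1 \<ge> 0" "?p2 \<ge> 0" by auto
  have "\<bar>flux m t\<bar> = \<bar>v\<^sub>1 m t - v\<^sub>2 m t\<bar> * \<bar>?p1 - ?p2\<bar>" by (simp add: flux_def abs_mult)
  also have "\<dots> \<le> 2 * C * (?p1 + ?p2)"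
  proof (rule mult_mono)
    show "\<bar>v\<^sub>1 m t - v\<^sub>2 m t\<bar> \<le> 2 * C" using F1.v_bound[OF m t] F2.v_bound[OF m t] by linarith
    show "\<bar>?p1 - ?p2\<bar> \<le> ?p1 + ?p2" using nn by linarith
    show "0 \<le> 2 * C" using F1.v_bound[OF m t] by linarith
  qed simp
  also have "\<dots> \<le> 2 * C * (((r\<^sub>1 m 0)\<^sup>2 * \<rho>\<^sub>1 m 0 powr \<gamma> + (r\<^sub>2 m 0)\<^sup>2 * \<rho>\<^sub>2 m 0 powr \<gamma>)
     * exp ((2 + 3 * \<gamma>) * C * T))"
    using F1.flux_le_initial[OF m t] F2.flux_le_initial[OF m t] F1.v_bound[OF m t]
    by (intro mult_left_mono) (auto simp: distrib_right)
  finally show ?thesis .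
qed

end

text \<open>Equal data make both ratios 1 at time 0, and each logarithmic derivative is a difference
  of two rates bounded by \<open>C\<close>, whence \<open>2 * C\<close>. The bounds are uniform in
  \<open>m\<close> up to the centre and the vacuum.\<close>

lemma ratio_bounds:
  assumes m: "m \<in> {0<..<M}" and t: "t \<in> {0..T}"
  defines "K \<equiv> exp (2 * C * T)"
  shows "1 / K \<le> X m t" "X m t \<le> K" "1 / K \<le> Y m t" "Y m t \<le> K"
proof -
  have T: "0 \<in> {0..T}" using t by simp
  have X0: "X m 0 = 1" using F2.r_pos[OF m T] r_initial[OF m] by (simp add: X_def)
  have Y0: "Y m 0 = 1"
    using F2.r_pos[OF m T] F2.\<rho>_pos[OF m T] r_initial[OF m] \<rho>_initial[OF m] by (simp add: Y_def)
  have kX: "\<bar>v\<^sub>1 m s / r\<^sub>1 m s - v\<^sub>2 m s / r\<^sub>2 m s\<bar> \<le> 2 * C" if "s \<in> {0..T}" for s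
    using F1.v_le_r[OF m that] F2.v_le_r[OF m that] by linarith
  have kY: "\<bar>\<beta>\<^sub>1 m s - \<beta>\<^sub>2 m s\<bar> \<le> 2 * C" if "s \<in> {0..T}" for s
    using F1.\<beta>_bound[OF m that] F2.\<beta>_bound[OF m that] by linarith
  show "1 / K \<le> X m t" "X m t \<le> K"
    unfolding K_def using exponential_two_sided_bound[OF X_t[OF m] positive(5)[OF m] kX X0 t] by auto
  show "1 / K \<le> Y m t" "Y m t \<le> K"
    unfolding K_def using exponential_two_sided_bound[OF Y_t[OF m] positive(6)[OF m] kY Y0 t] by auto
qed

lemma energy_initial: "m \<in> {0<..<M} \<Longrightarrow> 0 \<le> T \<Longrightarrow> energy m 0 = 0"
  using F2.r_pos[of m 0] F2.\<rho>_pos[of m 0] r_initial[of m] \<rho>_initial[of m] v_initial[of m]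
  by (simp add: energy_def X_def Y_def relative_potential_def)

lemma energy_t_le:
  assumes "0 \<le> T"
  obtains N where "\<And>m t. m \<in> {0<..<M} \<Longrightarrow> t \<in> {0..T} \<Longrightarrow> energy_t m t \<le> - flux_m m t + N * energy m t"
proof (cases "0 < M")
  case False
  then show ?thesis by (intro that) auto
next
  case True
  \<comment> \<open>Some label is required to read off from the velocity bound that \<open>C\<close>
    is nonnegative.\<close>
  then have "M / 2 \<in> {0<..<M}" by simp
  then have C: "C \<ge> 0" using F1.v_bound[of "M / 2" 0] assms by simp
  have K: "1 \<le> exp (2 * C * T)" using C assms by simp
  obtain N where N: "\<And>X Y \<alpha> \<beta>. \<lbrakk>1 / exp (2 * C * T) \<le> X; X \<le> exp (2 * C * T);
       1 / exp (2 * C * T) \<le> Y; Y \<le> exp (2 * C * T); \<bar>\<alpha>\<bar> \<le> C; \<bar>\<beta>\<bar> \<le> C\<rbrakk> \<Longrightarrow>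
       - (\<gamma> - 1) * (2 * \<alpha> + \<beta>) * relative_potential \<gamma> X Y
       + 2 * \<alpha> * ((X - 1) * (X powr (2 * (1 - \<gamma>)) * Y powr (1 - \<gamma>) / X - 1))
       + \<beta> * ((Y - 1) * (X powr (2 * (1 - \<gamma>)) * Y powr (1 - \<gamma>) / Y - 1))
       \<le> N * relative_potential \<gamma> X Y"
    using relative_potential_remainder[OF F1.\<gamma> K C] by blast
  show ?thesis
  \<comment> \<open>Replacing the potential part by the whole \<open>energy\<close> adds a
    nonnegative kinetic term, so the coefficient has to be nonnegative.\<close>
  proof (rule that[of "\<bar>N\<bar>"])
    fix m t assume m: "m \<in> {0<..<M}" and t: "t \<in> {0..T}"
    let ?S = "\<rho>\<^sub>2 m t powr (\<gamma> - 1)" and ?P = "relative_potential \<gamma> (X m t) (Y m t)"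
    have "energy_t m t \<le> - flux_m m t + ?S * (N * ?P)"
      unfolding energy_t_eq[OF m t]
      by (intro add_left_mono mult_left_mono N ratio_bounds[OF m t] F2.v_le_r[OF m t] F2.\<beta>_bound[OF m t]) simp
    also have "?S * (N * ?P) \<le> \<bar>N\<bar> * (?S * ?P)"
      using relative_potential_nonneg[OF F1.\<gamma> positive(5,6)[OF m t]]
        mult_right_mono[of N "\<bar>N\<bar>" "?S * ?P"] by (simp add: mult_ac)
    also have "\<dots> \<le> \<bar>N\<bar> * energy m t" by (intro mult_left_mono) (auto simp: energy_def)
    finally show "energy_t m t \<le> - flux_m m t + \<bar>N\<bar> * energy m t" by simp
  qed
qed

lemma flux_small:
  assumes "0 < M" "0 \<le> T" "0 < \<delta>"
  shows "\<forall>\<^sub>F m in at_right 0. \<forall>t\<in>{0..T}. \<bar>flux m t\<bar> \<le> \<delta>"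
    and "\<forall>\<^sub>F m in at_left M. \<forall>t\<in>{0..T}. \<bar>flux m t\<bar> \<le> \<delta>"
proof -
  let ?b = "\<lambda>m. 2 * C * (((r\<^sub>1 m 0)\<^sup>2 * \<rho>\<^sub>1 m 0 powr \<gamma> + (r\<^sub>2 m 0)\<^sup>2 * \<rho>\<^sub>2 m 0 powr \<gamma>)
     * exp ((2 + 3 * \<gamma>) * C * T))"
  have *: "\<forall>\<^sub>F m in F. \<forall>t\<in>{0..T}. \<bar>flux m t\<bar> \<le> \<delta>"
    if "(?b \<longlongrightarrow> 2 * C * ((0 + 0) * exp ((2 + 3 * \<gamma>) * C * T))) F" "\<forall>\<^sub>F m in F. m \<in> {0<..<M}" for F
  proof -
    have "\<forall>\<^sub>F m in F. ?b m < \<delta>" using order_tendstoD(2)[OF that(1), of \<delta>] assms by simp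
    then show ?thesis using that(2)
    proof eventually_elim
      case (elim m)
      show ?case using abs_flux_le[OF elim(2)] elim(1) by fastforce
    qed
  qed
  show "\<forall>\<^sub>F m in at_right 0. \<forall>t\<in>{0..T}. \<bar>flux m t\<bar> \<le> \<delta>"
    by (rule *, (rule tendsto_intros F1.initial_flux_0 F2.initial_flux_0)+)
      (use assms eventually_at_right[of 0 M] in auto)
  show "\<forall>\<^sub>F m in at_left M. \<forall>t\<in>{0..T}. \<bar>flux m t\<bar> \<le> \<delta>"
    by (rule *, (rule tendsto_intros F1.initial_flux_M F2.initial_flux_M)+)
      (use assms eventually_at_left[of 0 M] in auto)
qed

lemma continuous_energy:
  "continuous_on ({0<..<M} \<times> {0..T}) (\<lambda>z. energy (fst z) (snd z))"
  "continuous_on ({0<..<M} \<times> {0..T}) (\<lambda>z. energy_t (fst z) (snd z))"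
proof -
  note [continuous_intros] = F1.cont_r F1.cont_v F1.cont_\<rho> F1.cont_\<beta> F1.cont_dp
    F2.cont_r F2.cont_v F2.cont_\<rho> F2.cont_\<beta> F2.cont_dp
  have nz: "r\<^sub>1 (fst z) (snd z) \<noteq> 0" "r\<^sub>2 (fst z) (snd z) \<noteq> 0" "\<rho>\<^sub>1 (fst z) (snd z) \<noteq> 0"
    "\<rho>\<^sub>2 (fst z) (snd z) \<noteq> 0" "X (fst z) (snd z) \<noteq> 0" "Y (fst z) (snd z) \<noteq> 0"
    if "z \<in> {0<..<M} \<times> {0..T}" for z
    using positive[of "fst z" "snd z"] that by (auto simp: mem_Times_iff)
  have X: "continuous_on ({0<..<M} \<times> {0..T}) (\<lambda>z. X (fst z) (snd z))"
    unfolding X_def by (intro continuous_intros) (use nz in auto)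
  have Y: "continuous_on ({0<..<M} \<times> {0..T}) (\<lambda>z. Y (fst z) (snd z))"
    unfolding Y_def by (intro continuous_intros) (use nz in \<open>auto simp del: greaterThanLessThan_iff atLeastAtMost_iff\<close>)
  have P: "continuous_on ({0<..<M} \<times> {0..T})
      (\<lambda>z. relative_potential \<gamma> (X (fst z) (snd z)) (Y (fst z) (snd z)))"
    unfolding relative_potential_def by (intro continuous_intros X Y) (use nz F1.\<gamma> in auto)
  show "continuous_on ({0<..<M} \<times> {0..T}) (\<lambda>z. energy (fst z) (snd z))"
    unfolding energy_def by (intro continuous_intros P) (use nz in auto)
  show "continuous_on ({0<..<M} \<times> {0..T}) (\<lambda>z. energy_t (fst z) (snd z))"
    unfolding energy_t_def by (intro continuous_intros P X Y) (use nz in auto)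
qed


text \<open>Neither \<open>energy\<close> nor \<open>flux_m\<close> is known to be integrable up to
  \<open>0\<close> or \<open>M\<close>. The Gronwall estimate is therefore made on
  \<open>{a..b}\<close>, with the flux at both ends as error, and \<open>a\<close>, \<open>b\<close>
  are then moved to labels where the flux is at most \<open>\<delta>\<close> at all times.\<close>

lemma energy_zero:
  assumes T: "0 \<le> T" and m: "m \<in> {0<..<M}" and t: "t \<in> {0..T}"
  shows "energy m t = 0"
proof -
  obtain N where N: "\<And>m t. m \<in> {0<..<M} \<Longrightarrow> t \<in> {0..T} \<Longrightarrow>
      energy_t m t \<le> - flux_m m t + N * energy m t"
    using energy_t_le[OF T] by blast
  have M: "0 < M" using m by simp
  define E where "E = (\<lambda>a b t. integral {a..b} (\<lambda>m. energy m t))"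
  have sub: "{a..b} \<times> {0..T} \<subseteq> {0<..<M} \<times> {0..T}" if "0 < a" "b < M" for a b
    using that by auto
  have int: "(\<lambda>m. energy m s) integrable_on {a..b}" if "0 < a" "b < M" "s \<in> {0..T}" for a b s
    by (intro integrable_continuous_interval
        continuous_on_compose2[OF continuous_energy(1), where f = "\<lambda>m. (m, s)", simplified])
      (use that in \<open>auto intro!: continuous_intros\<close>)
  have E_nonneg: "0 \<le> E a b s" if "0 < a" "b < M" "s \<in> {0..T}" for a b s
    unfolding E_def by (intro integral_nonneg int energy_nonneg that) (use that in auto)
  \<comment> \<open>Gronwall with the integrating factor \<open>exp (- N * t)\<close>: each end of
    the interval contributes one \<open>\<delta>\<close>, and \<open>exp (\<bar>N\<bar> * T)\<close>
    dominates the factor whatever the sign of \<open>N\<close>.\<close>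
  have weighted: "exp (- N * t) * E a b t \<le> 2 * \<delta> * exp (\<bar>N\<bar> * T) * t"
    if ab: "0 < a" "a \<le> b" "b < M" and t: "t \<in> {0..T}"
      and fa: "\<forall>t\<in>{0..T}. \<bar>flux a t\<bar> \<le> \<delta>" and fb: "\<forall>t\<in>{0..T}. \<bar>flux b t\<bar> \<le> \<delta>" for a b \<delta> t
  proof -
    define h where "h = (\<lambda>t. exp (- N * t) * E a b t - 2 * \<delta> * exp (\<bar>N\<bar> * T) * t)"
    define h' where "h' = (\<lambda>t. exp (- N * t) * (integral {a..b} (\<lambda>m. energy_t m t) - N * E a b t)
      - 2 * \<delta> * exp (\<bar>N\<bar> * T))"
    have "h t \<le> h 0"
    proof (rule le_initial_value[OF _ _ t, where h' = h'])
      fix s assume s: "s \<in> {0..T}"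
      have cont: "continuous_on ({0..T} \<times> cbox a b) (\<lambda>(t, m). energy_t m t)"
        unfolding split_beta
        by (rule continuous_on_compose2[OF continuous_energy(2), where f = prod.swap, simplified])
          (use ab in \<open>auto intro!: continuous_on_swap\<close>)
      have "(E a b has_real_derivative integral {a..b} (\<lambda>m. energy_t m s)) (at s within {0..T})"
        unfolding E_def cbox_interval[of a b, symmetric]
        by (rule leibniz_rule_field_derivative[OF _ _ cont s])
          (use ab int energy_has_derivative in auto)
      then show "(h has_real_derivative h' s) (at s within {0..T})"
        unfolding h_def h'_def by (auto intro!: derivative_eq_intros simp: algebra_simps)
      have f: "((\<lambda>m. flux_m m s) has_integral (flux b s - flux a s)) {a..b}"
      proof (intro fundamental_theorem_of_calculus)
        fix m assume "m \<in> {a..b}"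
        then have "m \<in> {0<..<M}" using ab by auto
        from has_field_derivative_at_within[OF flux_has_derivative[OF this s]]
        show "((\<lambda>m. flux m s) has_vector_derivative flux_m m s) (at m within {a..b})"
          by (simp add: has_real_derivative_iff_has_vector_derivative)
      qed (use ab in auto)
      have et: "(\<lambda>m. energy_t m s) integrable_on {a..b}"
        by (intro integrable_continuous_interval
            continuous_on_compose2[OF continuous_energy(2), where f = "\<lambda>m. (m, s)", simplified])
          (use ab s in \<open>auto intro!: continuous_intros\<close>)
      have "integral {a..b} (\<lambda>m. energy_t m s)
          \<le> integral {a..b} (\<lambda>m. - flux_m m s + N * energy m s)"
        using f int[OF ab(1,3) s] et ab s
        by (intro integral_le integrable_add integrable_neg integrable_on_mult_right N)
          (auto simp: integrable_on_def)
      also have "\<dots> = - (flux b s - flux a s) + N * E a b s"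
        unfolding E_def using f int[OF ab(1,3) s]
        by (intro integral_unique has_integral_add has_integral_neg has_integral_mult_right integrable_integral) auto
      finally have "integral {a..b} (\<lambda>m. energy_t m s) - N * E a b s \<le> 2 * \<delta>"
        using fa fb s by fastforce
      then have "exp (- N * s) * (integral {a..b} (\<lambda>m. energy_t m s) - N * E a b s)
          \<le> exp (- N * s) * (2 * \<delta>)" by (intro mult_left_mono) auto
      also have "\<dots> \<le> exp (\<bar>N\<bar> * T) * (2 * \<delta>)"
      proof (rule mult_right_mono)
        have "- N * s \<le> \<bar>N\<bar> * s" using s by (intro mult_right_mono) auto
        also have "\<dots> \<le> \<bar>N\<bar> * T" using s by (intro mult_left_mono) auto
        finally show "exp (- N * s) \<le> exp (\<bar>N\<bar> * T)" by simp
        show "0 \<le> 2 * \<delta>" using fa s by fastforce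
      qed
      finally show "h' s \<le> 0" by (simp add: h'_def mult_ac)
    qed
    moreover have "E a b 0 = 0"
      unfolding E_def using ab energy_initial[OF _ T]
      by (intro integral_unique has_integral_is_0) auto
    ultimately show ?thesis by (simp add: h_def)
  qed
  \<comment> \<open>This interval around \<open>m\<close> stays fixed. The intervals
    \<open>{a'..b'}\<close> below contain it, and since the energy is nonnegative their integrals
    dominate the one over it.\<close>
  define a where "a = m / 2"
  define b where "b = (m + M) / 2"
  have ab: "0 < a" "a < m" "m < b" "b < M" using m by (auto simp: a_def b_def)
  have "exp (- N * t) * E a b t \<le> 0"
  proof (rule field_le_epsilon)
    fix e :: real assume e: "0 < e"
    \<comment> \<open>Chosen so that the final bound is exactly \<open>e\<close>;
      \<open>T + 1\<close> instead of \<open>T\<close> keeps the denominator positive when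
      \<open>T = 0\<close>.\<close>
    define \<delta> where "\<delta> = e / (2 * exp (\<bar>N\<bar> * T) * (T + 1))"
    have \<delta>: "0 < \<delta>" using e T by (simp add: \<delta>_def)
    have "\<forall>\<^sub>F x in at_right 0. (\<forall>t\<in>{0..T}. \<bar>flux x t\<bar> \<le> \<delta>) \<and> x \<in> {0<..<a}"
      using flux_small(1)[OF M T \<delta>] eventually_at_right[of 0 a] ab
      by (intro eventually_conj) auto
    then obtain a' where a': "\<forall>t\<in>{0..T}. \<bar>flux a' t\<bar> \<le> \<delta>" "0 < a'" "a' < a"
      using eventually_happens'[OF trivial_limit_at_right_real] by fastforce
    have "\<forall>\<^sub>F x in at_left M. (\<forall>t\<in>{0..T}. \<bar>flux x t\<bar> \<le> \<delta>) \<and> x \<in> {b<..<M}"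
      using flux_small(2)[OF M T \<delta>] eventually_at_left[of b M] ab
      by (intro eventually_conj) auto
    then obtain b' where b': "\<forall>t\<in>{0..T}. \<bar>flux b' t\<bar> \<le> \<delta>" "b < b'" "b' < M"
      using eventually_happens'[OF trivial_limit_at_left_real] by fastforce
    have "E a b t \<le> E a' b' t"
      unfolding E_def using a' b' ab t
      by (intro integral_subset_le int) (auto intro!: energy_nonneg)
    then have "exp (- N * t) * E a b t \<le> exp (- N * t) * E a' b' t" by (intro mult_left_mono) auto
    also have "\<dots> \<le> 2 * \<delta> * exp (\<bar>N\<bar> * T) * t"
      by (rule weighted[OF _ _ _ t a'(1) b'(1)]) (use a' b' ab in auto)
    also have "\<dots> \<le> 2 * \<delta> * exp (\<bar>N\<bar> * T) * (T + 1)" using t \<delta> by (intro mult_left_mono) auto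
    also have "\<dots> = e" using T by (simp add: \<delta>_def)
    finally show "exp (- N * t) * E a b t \<le> 0 + e" by simp
  qed
  then have "E a b t \<le> 0" by (simp add: mult_le_0_iff)
  then have "integral {a..b} (\<lambda>m. energy m t) = 0" using E_nonneg[of a b t] ab t by (simp add: E_def)
  moreover have "continuous_on {a..b} (\<lambda>m. energy m t)"
    by (intro continuous_on_compose2[OF continuous_energy(1), where f = "\<lambda>m. (m, t)", simplified])
      (use ab t in \<open>auto intro!: continuous_intros\<close>)
  ultimately have "\<forall>x\<in>{a..b}. energy x t = 0"
    using integral_eq_0_iff[of a b "\<lambda>m. energy m t"] ab t energy_nonneg by auto
  then show ?thesis using ab by auto
qed

theorem lagrangian_uniqueness:
  assumes T: "0 \<le> T" and m: "m \<in> {0<..<M}" and t: "t \<in> {0..T}"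
  shows "r\<^sub>1 m t = r\<^sub>2 m t" "v\<^sub>1 m t = v\<^sub>2 m t" "\<rho>\<^sub>1 m t = \<rho>\<^sub>2 m t"
proof -
  note pos = positive[OF m t]
  let ?P = "relative_potential \<gamma> (X m t) (Y m t)"
  have P: "0 \<le> ?P" using relative_potential_nonneg[OF F1.\<gamma> pos(5,6)] .
  have "(v\<^sub>1 m t - v\<^sub>2 m t)\<^sup>2 / 2 + \<rho>\<^sub>2 m t powr (\<gamma> - 1) * ?P = 0"
    using energy_zero[OF assms] by (simp add: energy_def)
  moreover have "0 \<le> (v\<^sub>1 m t - v\<^sub>2 m t)\<^sup>2 / 2" "0 \<le> \<rho>\<^sub>2 m t powr (\<gamma> - 1) * ?P" using P by auto
  ultimately have "(v\<^sub>1 m t - v\<^sub>2 m t)\<^sup>2 / 2 = 0" "\<rho>\<^sub>2 m t powr (\<gamma> - 1) * ?P = 0" by linarith+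
  then have v: "v\<^sub>1 m t = v\<^sub>2 m t" and "?P = 0" using pos by auto
  \<comment> \<open>At a single point coercivity can be applied with the larger of the two ratios as
    \<open>K\<close>.\<close>
  then have "(X m t - 1)\<^sup>2 + (Y m t - 1)\<^sup>2 \<le> 0"
    using relative_potential_coercive[OF F1.\<gamma> pos(5,6), of "max (X m t) (Y m t)"] by simp
  then have "X m t = 1" "Y m t = 1" by (auto simp: sum_power2_le_zero_iff)
  then show "r\<^sub>1 m t = r\<^sub>2 m t" "\<rho>\<^sub>1 m t = \<rho>\<^sub>2 m t" using pos by (auto simp: X_def Y_def)
  show "v\<^sub>1 m t = v\<^sub>2 m t" by (rule v)
qed

end

subsection \<open>Radial flows and the mass coordinate\<close>

definition radial_domain :: "real \<Rightarrow> (real \<Rightarrow> real) \<Rightarrow> (real \<times> real) set" where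
  "radial_domain T R = {(r, t). t \<in> {0..T} \<and> 0 < r \<and> r \<le> R t}"

text \<open>A chain rule relative to a set \<open>D\<close> that need not be open: the curve only
  has to stay in \<open>D\<close>, which admits curves on the free boundary and one-sided
  derivatives at the end times.\<close>

lemma has_real_derivative_along_curve:
  fixes F :: "real \<Rightarrow> real \<Rightarrow> real"
  assumes F: "((\<lambda>z. F (fst z) (snd z)) has_derivative (\<lambda>h. Fr * fst h + Ft * snd h)) (at (r, t) within D)"
    and rt: "a s = r" "b s = t"
    and a: "(a has_real_derivative a') (at s within S)" and b: "(b has_real_derivative b') (at s within S)"
    and D: "\<And>x. x \<in> S \<Longrightarrow> (a x, b x) \<in> D"
  shows "((\<lambda>x. F (a x) (b x)) has_real_derivative Fr * a' + Ft * b') (at s within S)"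
proof -
  have "((\<lambda>x. (a x, b x)) has_derivative (\<lambda>h. (a' * h, b' * h))) (at s within S)"
    using has_derivative_Pair[OF a[unfolded has_field_derivative_def] b[unfolded has_field_derivative_def]] .
  then have "((\<lambda>x. F (fst (a x, b x)) (snd (a x, b x))) has_derivative
      (\<lambda>h. Fr * fst (a' * h, b' * h) + Ft * snd (a' * h, b' * h))) (at s within S)"
    by (rule has_derivative_in_compose[where g = "\<lambda>z. F (fst z) (snd z)"])
      (rule has_derivative_subset[OF F[folded rt]], use D in auto)
  then show ?thesis
    unfolding has_field_derivative_def
    by (simp add: algebra_simps rt) (erule has_derivative_eq_rhs, simp add: fun_eq_iff algebra_simps)
qed

lemma eventually_at_within_in: "\<forall>\<^sub>F x in at a within S. x \<in> S"
  by (simp add: eventually_at_filter)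

text \<open>The Euler system for the profiles \<open>g\<close> of the density and \<open>w\<close>
  of the velocity, with the momentum equation in nonconservative form. \<open>w_le_r\<close> bounds
  the tangential part of the velocity gradient; as the domain omits \<open>r = 0\<close>, it does
  not follow from \<open>wr_bound\<close>.\<close>

locale radial_flow =
  fixes \<gamma> T B :: real and R R' :: "real \<Rightarrow> real" and g w gr gt wr wt :: "real \<Rightarrow> real \<Rightarrow> real"
  assumes \<gamma>: "\<gamma> > 1" and T: "T \<ge> 0"
    and R_pos: "\<And>t. t \<in> {0..T} \<Longrightarrow> R t > 0"
    and R_t: "\<And>t. t \<in> {0..T} \<Longrightarrow> (R has_real_derivative R' t) (at t within {0..T})"
    and cont_R': "continuous_on {0..T} R'"
    and g_deriv: "\<And>r t. (r, t) \<in> radial_domain T R \<Longrightarrow>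
        ((\<lambda>z. g (fst z) (snd z)) has_derivative (\<lambda>h. gr r t * fst h + gt r t * snd h))
          (at (r, t) within radial_domain T R)"
    and w_deriv: "\<And>r t. (r, t) \<in> radial_domain T R \<Longrightarrow>
        ((\<lambda>z. w (fst z) (snd z)) has_derivative (\<lambda>h. wr r t * fst h + wt r t * snd h))
          (at (r, t) within radial_domain T R)"
    and cont_gr: "continuous_on (radial_domain T R) (\<lambda>z. gr (fst z) (snd z))"
    and cont_gt: "continuous_on (radial_domain T R) (\<lambda>z. gt (fst z) (snd z))"
    and cont_wr: "continuous_on (radial_domain T R) (\<lambda>z. wr (fst z) (snd z))"
    and cont_wt: "continuous_on (radial_domain T R) (\<lambda>z. wt (fst z) (snd z))"
    and g_bound: "\<And>r t. (r, t) \<in> radial_domain T R \<Longrightarrow> \<bar>g r t\<bar> \<le> B"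
    and gr_bound: "\<And>r t. (r, t) \<in> radial_domain T R \<Longrightarrow> \<bar>gr r t\<bar> \<le> B"
    and gt_bound: "\<And>r t. (r, t) \<in> radial_domain T R \<Longrightarrow> \<bar>gt r t\<bar> \<le> B"
    and w_bound: "\<And>r t. (r, t) \<in> radial_domain T R \<Longrightarrow> \<bar>w r t\<bar> \<le> B"
    and wr_bound: "\<And>r t. (r, t) \<in> radial_domain T R \<Longrightarrow> \<bar>wr r t\<bar> \<le> B"
    and w_le_r: "\<And>r t. (r, t) \<in> radial_domain T R \<Longrightarrow> \<bar>w r t / r\<bar> \<le> B"
    and g_pos: "\<And>r t. t \<in> {0..T} \<Longrightarrow> 0 < r \<Longrightarrow> r < R t \<Longrightarrow> g r t > 0"
    and g_boundary: "\<And>t. t \<in> {0..T} \<Longrightarrow> g (R t) t = 0"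
    and continuity_equation: "\<And>r t. t \<in> {0..T} \<Longrightarrow> 0 < r \<Longrightarrow> r < R t \<Longrightarrow>
        gt r t = - w r t * gr r t - g r t * (wr r t + 2 * (w r t / r))"
    and momentum_equation: "\<And>r t. t \<in> {0..T} \<Longrightarrow> 0 < r \<Longrightarrow> r < R t \<Longrightarrow>
        g r t * (wt r t + w r t * wr r t) + \<gamma> * g r t powr (\<gamma> - 1) * gr r t = 0"
begin

abbreviation D :: "(real \<times> real) set" where
  "D \<equiv> radial_domain T R"

section \<open>Enclosed mass in the rescaled radius\<close>

lemma cont_g: "continuous_on D (\<lambda>z. g (fst z) (snd z))"
proof (rule has_derivative_continuous_on)
  fix z assume "z \<in> D"
  then show "((\<lambda>z. g (fst z) (snd z)) has_derivative
      (\<lambda>h. gr (fst z) (snd z) * fst h + gt (fst z) (snd z) * snd h)) (at z within D)"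
    using g_deriv[of "fst z" "snd z"] by simp
qed

lemma cont_w: "continuous_on D (\<lambda>z. w (fst z) (snd z))"
proof (rule has_derivative_continuous_on)
  fix z assume "z \<in> D"
  then show "((\<lambda>z. w (fst z) (snd z)) has_derivative
      (\<lambda>h. wr (fst z) (snd z) * fst h + wt (fst z) (snd z) * snd h)) (at z within D)"
    using w_deriv[of "fst z" "snd z"] by simp
qed

lemma cont_R: "continuous_on {0..T} R"
  using R_t by (rule DERIV_continuous_on)

lemma scaled_in_D: "z \<in> {0<..1} \<Longrightarrow> t \<in> {0..T} \<Longrightarrow> (R t * z, t) \<in> D"
  using R_pos[of t] by (auto simp: radial_domain_def mult_le_cancel_left1)

text \<open>\<open>F\<close> is merely bounded near the centre and may have no limit there; the
  square from the volume element makes the product continuous with value 0, hence continuous on a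
  compact rectangle.\<close>

lemma continuous_on_weighted:
  assumes F: "continuous_on D (\<lambda>z. F (fst z) (snd z))"
    and bound: "\<And>r t. (r, t) \<in> D \<Longrightarrow> \<bar>F r t\<bar> \<le> L"
  shows "continuous_on ({0..1} \<times> {0..T}) (\<lambda>z. (fst z)\<^sup>2 * F (R (snd z) * fst z) (snd z))"
    (is "continuous_on ?S ?f")
  unfolding continuous_on_eq_continuous_within
proof
  fix p assume p: "p \<in> ?S"
  show "continuous (at p within ?S) ?f"
  proof (cases "fst p = 0")
    case True
    have "\<forall>\<^sub>F z in at p within ?S. norm (?f z) \<le> (fst z)\<^sup>2 * L"
      using eventually_at_within_in
    proof (rule eventually_mono)
      show "norm (?f z) \<le> (fst z)\<^sup>2 * L" if "z \<in> ?S" for z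
      proof (cases "fst z = 0")
        case False
        then have "\<bar>F (R (snd z) * fst z) (snd z)\<bar> \<le> L"
          using that by (intro bound scaled_in_D) (auto simp: mem_Times_iff)
        then show ?thesis by (simp add: abs_mult mult_left_mono)
      qed simp
    qed
    moreover have "((\<lambda>z. (fst z)\<^sup>2 * L) \<longlongrightarrow> (fst p)\<^sup>2 * L) (at p within ?S)"
      by (intro tendsto_intros)
    ultimately have "(?f \<longlongrightarrow> 0) (at p within ?S)"
      using Lim_null_comparison[of ?f "\<lambda>z. (fst z)\<^sup>2 * L"] True by simp
    then show ?thesis using True by (simp add: continuous_within)
  next
    case False
    have "continuous_on ({0<..1} \<times> {0..T}) (\<lambda>z. F (R (snd z) * fst z) (snd z))"
      by (rule continuous_on_compose2[OF F, where f = "\<lambda>z. (R (snd z) * fst z, snd z)", simplified])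
        (use scaled_in_D in \<open>auto intro!: continuous_intros continuous_on_compose2[OF cont_R]\<close>)
    then have "continuous_on ({0<..1} \<times> {0..T}) ?f" by (intro continuous_intros)
    moreover have "p \<in> {0<..1} \<times> {0..T}" using p False by (cases p) auto
    ultimately have "continuous (at p within {0<..1} \<times> {0..T}) ?f"
      unfolding continuous_on_eq_continuous_within by blast
    moreover have "at p within ?S = at p within {0<..1} \<times> {0..T}"
      by (rule at_within_nhd[where S = "{0<..} \<times> UNIV"])
        (use p False in \<open>auto simp: mem_Times_iff open_Times\<close>)
    ultimately show ?thesis by simp
  qed
qed

text \<open>
  In the rescaled variable \<open>z = r / R t\<close> the domain is a fixed rectangle, so the enclosed mass can
  be differentiated under the integral sign up to the boundary.
\<close>

definition k :: "real \<Rightarrow> real \<Rightarrow> real" where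
  "k z t = (R t)^3 * (z\<^sup>2 * g (R t * z) t)"

definition k_t :: "real \<Rightarrow> real \<Rightarrow> real" where
  "k_t z t = 3 * (R t)\<^sup>2 * R' t * (z\<^sup>2 * g (R t * z) t)
     + (R t)^3 * (z\<^sup>2 * gr (R t * z) t) * (R' t * z) + (R t)^3 * (z\<^sup>2 * gt (R t * z) t)"

text \<open>With \<open>r = R t * z\<close> this is
  \<open>r\<^sup>2 * g r t * (w r t - R' t * z)\<close>, the mass flux through a sphere that itself
  moves with speed \<open>R' t * z\<close>.\<close>

definition q :: "real \<Rightarrow> real \<Rightarrow> real" where
  "q z t = (R t)\<^sup>2 * (z\<^sup>2 * (g (R t * z) t * w (R t * z) t)) - (R t)\<^sup>2 * R' t * z * (z\<^sup>2 * g (R t * z) t)"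

text \<open>By the substitution \<open>r = R t * z\<close>, the mass inside the sphere of radius
  \<open>R t * y\<close>, divided by 4 \<pi>.\<close>

definition mass :: "real \<Rightarrow> real \<Rightarrow> real" where
  "mass y t = integral {0..y} (\<lambda>z. k z t)"

lemma cont_R_snd: "continuous_on (S \<times> {0..T}) (\<lambda>z. R (snd z))"
  by (rule continuous_on_compose2[OF cont_R]) (auto intro!: continuous_intros)

lemma cont_R'_snd: "continuous_on (S \<times> {0..T}) (\<lambda>z. R' (snd z))"
  by (rule continuous_on_compose2[OF cont_R']) (auto intro!: continuous_intros)

lemma cont_k: "continuous_on ({0..1} \<times> {0..T}) (\<lambda>z. k (fst z) (snd z))"
  unfolding k_def by (intro continuous_intros continuous_on_weighted[OF cont_g g_bound] cont_R_snd)

lemma cont_k_t: "continuous_on ({0..1} \<times> {0..T}) (\<lambda>z. k_t (fst z) (snd z))"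
  unfolding k_t_def
  by (intro continuous_on_add continuous_on_mult continuous_on_power continuous_on_const
      continuous_on_fst continuous_on_id
      continuous_on_weighted[OF cont_g g_bound] continuous_on_weighted[OF cont_gr gr_bound]
      continuous_on_weighted[OF cont_gt gt_bound] cont_R_snd cont_R'_snd)

lemma cont_q: "continuous_on ({0..1} \<times> {0..T}) (\<lambda>z. q (fst z) (snd z))"
proof -
  have "\<bar>g r t * w r t\<bar> \<le> B * B" if "(r, t) \<in> D" for r t
    unfolding abs_mult using g_bound[OF that] w_bound[OF that] by (intro mult_mono) auto
  note gw = continuous_on_weighted[OF continuous_on_mult[OF cont_g cont_w] this]
  show ?thesis
    unfolding q_def
    by (intro continuous_on_diff continuous_on_mult continuous_on_power continuous_on_fst continuous_on_id
      continuous_on_weighted[OF cont_g g_bound] gw cont_R_snd cont_R'_snd)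
qed

lemma cont_slice:
  assumes "continuous_on ({0..1} \<times> {0..T}) (\<lambda>z. F (fst z) (snd z))" "t \<in> {0..T}" "S \<subseteq> {0..1}"
  shows "continuous_on S (\<lambda>z. F z t)"
  by (rule continuous_on_compose2[OF assms(1), where f = "\<lambda>z. (z, t)", simplified])
    (use assms(2,3) in \<open>auto intro!: continuous_intros\<close>)

lemma k_pos: "0 < z \<Longrightarrow> z < 1 \<Longrightarrow> t \<in> {0..T} \<Longrightarrow> 0 < k z t"
  using R_pos[of t] g_pos[of t "R t * z"] by (simp add: k_def)

lemma k_has_derivative_t:
  assumes z: "z \<in> {0..1}" and t: "t \<in> {0..T}"
  shows "((\<lambda>t. k z t) has_real_derivative k_t z t) (at t within {0..T})"
proof (cases "z = 0")
  case False
  then have z': "z \<in> {0<..1}" using z by auto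
  have G: "((\<lambda>t. g (R t * z) t) has_real_derivative gr (R t * z) t * (R' t * z) + gt (R t * z) t * 1)
      (at t within {0..T})"
    by (rule has_real_derivative_along_curve[OF g_deriv[OF scaled_in_D[OF z' t]]])
      (use scaled_in_D[OF z'] in \<open>auto intro!: derivative_eq_intros R_t t\<close>)
  show ?thesis
    unfolding k_def k_t_def
    by (rule derivative_eq_intros G R_t t refl)+ (simp add: algebra_simps power2_eq_square power3_eq_cube)
qed (simp add: k_def k_t_def)

text \<open>The continuity equation in conservation form for the variable \<open>z\<close>. It is
  posed only for \<open>0 < r\<close> and \<open>r < R t\<close>, hence the strict bounds on
  \<open>z\<close>.\<close>

lemma q_has_derivative:
  assumes z: "0 < z" "z < 1" and t: "t \<in> {0..T}"
  shows "((\<lambda>z. q z t) has_real_derivative - k_t z t) (at z)"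
proof -
  have z': "z \<in> {0<..<1}" using z by auto
  have *: "((\<lambda>z. F (R t * z) t) has_real_derivative Fr * R t) (at z)"
    if F: "((\<lambda>z. F (fst z) (snd z)) has_derivative (\<lambda>h. Fr * fst h + Ft * snd h))
          (at (R t * z, t) within radial_domain T R)" for F Fr Ft
  proof -
    have "((\<lambda>z. F (R t * z) t) has_real_derivative Fr * R t + Ft * 0) (at z within {0<..<1})"
      by (rule has_real_derivative_along_curve[OF F])
        (use scaled_in_D[OF _ t] in \<open>auto intro!: derivative_eq_intros\<close>)
    then show ?thesis using z' at_within_open[of z "{0<..<1}"] by simp
  qed
  have D: "(R t * z, t) \<in> D" using scaled_in_D[OF _ t] z by auto
  note G = *[OF g_deriv[OF D]] and W = *[OF w_deriv[OF D]]
  have Rt: "0 < R t" using R_pos t by auto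
  have ce: "R t * z * gt (R t * z) t = - (R t * z) * (w (R t * z) t * gr (R t * z) t)
      - (R t * z) * (g (R t * z) t * wr (R t * z) t) - 2 * g (R t * z) t * w (R t * z) t"
    using continuity_equation[OF t, of "R t * z"] z Rt by (simp add: field_simps)
  show ?thesis
    unfolding q_def k_t_def
    by (rule DERIV_cong, (rule derivative_intros G W)+) (use ce in \<open>simp, algebra\<close>)
qed

lemma mass_has_derivative:
  assumes y: "y \<in> {0..1}" and t: "t \<in> {0..T}"
  shows "((\<lambda>y. mass y t) has_real_derivative k y t) (at y within {0..1})"
  unfolding mass_def
  by (rule integral_has_real_derivative[OF cont_slice[OF cont_k t] y]) simp

lemma mass_has_derivative_at:
  assumes y: "y \<in> {0<..<1}" and t: "t \<in> {0..T}"
  shows "((\<lambda>y. mass y t) has_real_derivative k y t) (at y)"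
  using mass_has_derivative[of y t] y t at_within_interior[of y "{0..1}"] by simp

lemma mass_has_derivative_t:
  assumes y: "y \<in> {0..1}" and t: "t \<in> {0..T}"
  shows "((\<lambda>t. mass y t) has_real_derivative - q y t) (at t within {0..T})"
proof -
  have cont: "continuous_on ({0..T} \<times> cbox 0 y) (\<lambda>(t, z). k_t z t)"
    unfolding split_beta
    by (rule continuous_on_compose2[OF cont_k_t, where f = prod.swap, simplified])
      (use y in \<open>auto intro!: continuous_on_swap\<close>)
  have "((\<lambda>t. mass y t) has_real_derivative integral {0..y} (\<lambda>z. k_t z t)) (at t within {0..T})"
    unfolding mass_def cbox_interval[of 0 y, symmetric]
    by (rule leibniz_rule_field_derivative[OF _ _ cont t])
      (use y k_has_derivative_t in \<open>auto intro!: integrable_continuous_interval cont_slice[OF cont_k]\<close>)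
  \<comment> \<open>\<open>q\<close> is differentiable only inside the interval, but continuous up
    to its ends, which is enough here; moreover \<open>q 0 t\<close> is 0.\<close>
  moreover have "((\<lambda>z. - k_t z t) has_integral q y t - q 0 t) {0..y}"
    by (rule fundamental_theorem_of_calculus_interior)
      (use y t q_has_derivative in \<open>auto intro!: cont_slice[OF cont_q]
         simp flip: has_real_derivative_iff_has_vector_derivative\<close>)
  then have "integral {0..y} (\<lambda>z. k_t z t) = - q y t"
    using has_integral_neg[of "\<lambda>z. - k_t z t" "q y t" "{0..y}"] by (simp add: q_def integral_unique)
  ultimately show ?thesis by simp
qed

section \<open>Labelling the shells by mass\<close>

definition M :: real where
  "M = mass 1 0"

lemma mass_0 [simp]: "mass 0 t = 0"
  by (simp add: mass_def)

text \<open>No mass crosses the free boundary: both terms of \<open>q 1 t\<close> contain the factor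
  \<open>g (R t) t\<close>, which vanishes.\<close>

lemma mass_1: "t \<in> {0..T} \<Longrightarrow> mass 1 t = M"
proof -
  have "((\<lambda>t. mass 1 t) has_real_derivative 0) (at s within {0..T})" if "s \<in> {0..T}" for s
    using mass_has_derivative_t[of 1 s] that g_boundary[OF that] by (simp add: q_def)
  then obtain c where "\<And>s. s \<in> {0..T} \<Longrightarrow> mass 1 s = c"
    using has_field_derivative_zero_constant[of "{0..T}" "\<lambda>t. mass 1 t"] by auto
  then show "t \<in> {0..T} \<Longrightarrow> mass 1 t = M" using T by (simp add: M_def)
qed

lemma cont_mass: "t \<in> {0..T} \<Longrightarrow> continuous_on {0..1} (\<lambda>y. mass y t)"
  using mass_has_derivative by (intro DERIV_continuous_on)

lemma mass_strict_mono:
  assumes "0 \<le> y" "y < y'" "y' \<le> 1" "t \<in> {0..T}"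
  shows "mass y t < mass y' t"
proof (rule DERIV_pos_imp_increasing_open[where f = "\<lambda>y. mass y t"])
  show "\<exists>d. ((\<lambda>y. mass y t) has_real_derivative d) (at x) \<and> 0 < d" if "y < x" "x < y'" for x
    using mass_has_derivative_at[of x t] k_pos[of x t] that assms by auto
  show "continuous_on {y..y'} (\<lambda>y. mass y t)"
    by (rule continuous_on_subset[OF cont_mass]) (use assms in auto)
qed (use assms in auto)

lemma mass_less_iff:
  assumes "y \<in> {0..1}" "y' \<in> {0..1}" "t \<in> {0..T}"
  shows "mass y t < mass y' t \<longleftrightarrow> y < y'"
  using mass_strict_mono[of y y' t] mass_strict_mono[of y' y t] assms
  by (cases y y' rule: linorder_cases) auto

lemma mass_inj:
  assumes "mass y t = mass y' t" "y \<in> {0..1}" "y' \<in> {0..1}" "t \<in> {0..T}"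
  shows "y = y'"
  using mass_strict_mono[of y y' t] mass_strict_mono[of y' y t] assms
  by (cases y y' rule: linorder_cases) auto

text \<open>The inverse of \<open>mass\<close> at fixed time, that is, the rescaled radius of the
  shell with label \<open>m\<close>; not to be confused with the ratio \<open>Y\<close> of two
  flows.\<close>

definition Y :: "real \<Rightarrow> real \<Rightarrow> real" where
  "Y m t = (THE y. y \<in> {0<..<1} \<and> mass y t = m)"

lemma Y:
  assumes "m \<in> {0<..<M}" "t \<in> {0..T}"
  shows "Y m t \<in> {0<..<1}" "mass (Y m t) t = m"
proof -
  obtain y where "0 \<le> y" "y \<le> 1" "mass y t = m"
    using IVT'[of "\<lambda>y. mass y t" 0 m 1] assms mass_1 cont_mass by auto
  moreover from this have "y \<noteq> 0" "y \<noteq> 1" using assms mass_1 by auto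
  ultimately have y: "y \<in> {0<..<1}" "mass y t = m" by auto
  have "\<exists>!y. y \<in> {0<..<1} \<and> mass y t = m"
  proof (rule ex1I[of _ y])
    fix y' assume "y' \<in> {0<..<1} \<and> mass y' t = m"
    then show "y' = y" using mass_inj[of y' t y] y assms(2) by auto
  qed (use y in simp)
  from theI'[OF this] show "Y m t \<in> {0<..<1}" "mass (Y m t) t = m" by (auto simp: Y_def)
qed

lemma Y_eq:
  assumes "y \<in> {0<..<1}" "t \<in> {0..T}"
  shows "mass y t \<in> {0<..<M}" "Y (mass y t) t = y"
proof -
  show *: "mass y t \<in> {0<..<M}"
    using mass_less_iff[of 0 y t] mass_less_iff[of y 1 t] assms mass_1 by auto
  show "Y (mass y t) t = y"
    using Y[OF * assms(2)] mass_inj[of "Y (mass y t) t" t y] assms by auto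
qed

lemma Y_less_iff:
  assumes "m \<in> {0<..<M}" "y \<in> {0..1}" "t \<in> {0..T}"
  shows "Y m t < y \<longleftrightarrow> m < mass y t" "y < Y m t \<longleftrightarrow> mass y t < m"
  using mass_less_iff[of "Y m t" y t] mass_less_iff[of y "Y m t" t] Y[of m t] assms by auto

text \<open>Monotonicity gives joint continuity: \<open>Y_less_iff\<close> turns a strict bound on
  \<open>Y\<close> into one between the label and \<open>mass\<close> at a fixed \<open>y\<close>,
  and the latter is continuous in time.\<close>

lemma tendsto_Y:
  assumes m: "(\<mu> \<longlongrightarrow> m) F" and t: "(\<tau> \<longlongrightarrow> t) F" and mM: "m \<in> {0<..<M}" and tT: "t \<in> {0..T}"
    and F: "\<forall>\<^sub>F x in F. \<mu> x \<in> {0<..<M}" "\<forall>\<^sub>F x in F. \<tau> x \<in> {0..T}"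
  shows "((\<lambda>x. Y (\<mu> x) (\<tau> x)) \<longlongrightarrow> Y m t) F"
proof -
  have mass: "((\<lambda>x. mass y (\<tau> x)) \<longlongrightarrow> mass y t) F" if "y \<in> {0..1}" for y
    by (rule continuous_on_tendsto_compose[OF DERIV_continuous_on[OF mass_has_derivative_t[OF that]] t tT F(2)])
  note Yt = Y[OF mM tT]
  show ?thesis
  proof (rule order_tendstoI)
    fix a assume a: "a < Y m t"
    \<comment> \<open>Clamped to the unit interval, where \<open>mass\<close> is strictly increasing
      and continuous in time.\<close>
    define y where "y = max 0 a"
    have y: "y \<in> {0..1}" "y < Y m t" "a \<le> y" using a Yt by (auto simp: y_def)
    then have "mass y t < m" using Y_less_iff(2)[OF mM y(1) tT] by simp
    then obtain c where c: "mass y t < c" "c < m" using dense by blast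
    show "\<forall>\<^sub>F x in F. a < Y (\<mu> x) (\<tau> x)"
      using order_tendstoD(2)[OF mass[OF y(1)] c(1)] order_tendstoD(1)[OF m c(2)] F
    proof eventually_elim
      case (elim x)
      then show ?case using Y_less_iff(2)[of "\<mu> x" y "\<tau> x"] y by auto
    qed
  next
    fix a assume a: "Y m t < a"
    define y where "y = min 1 a"
    have y: "y \<in> {0..1}" "Y m t < y" "y \<le> a" using a Yt by (auto simp: y_def)
    then have "m < mass y t" using Y_less_iff(1)[OF mM y(1) tT] by simp
    then obtain c where c: "m < c" "c < mass y t" using dense by blast
    show "\<forall>\<^sub>F x in F. Y (\<mu> x) (\<tau> x) < a"
      using order_tendstoD(1)[OF mass[OF y(1)] c(2)] order_tendstoD(2)[OF m c(1)] F
    proof eventually_elim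
      case (elim x)
      then show ?case using Y_less_iff(1)[of "\<mu> x" y "\<tau> x"] y by auto
    qed
  qed
qed

lemma cont_Y: "continuous_on ({0<..<M} \<times> {0..T}) (\<lambda>z. Y (fst z) (snd z))"
  unfolding continuous_on
  by (intro ballI tendsto_Y tendsto_intros eventually_mono[OF eventually_at_within_in]) auto

lemma Y_m:
  assumes m: "m \<in> {0<..<M}" and t: "t \<in> {0..T}"
  shows "((\<lambda>m. Y m t) has_real_derivative 1 / k (Y m t) t) (at m)"
proof -
  note Yt = Y[OF m t]
  have "\<forall>\<^sub>F x in at m. x \<in> {0<..<M}" using m by (intro eventually_at_in_open') auto
  then have "isCont (\<lambda>m. Y m t) m"
    unfolding isCont_def using m t by (intro tendsto_Y tendsto_intros) auto
  then have "((\<lambda>m. Y m t) has_real_derivative inverse (k (Y m t) t)) (at m)"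
    by (intro DERIV_inverse_function[where f = "\<lambda>y. mass y t" and a = 0 and b = M]
        mass_has_derivative_at[OF Yt(1) t])
      (use m t Yt k_pos[of "Y m t" t] Y in auto)
  then show ?thesis by (simp add: inverse_eq_divide)
qed

text \<open>Implicit differentiation of \<open>mass (Y m t) t = m\<close>, valid also one-sidedly at
  the end times. The mean value theorem in \<open>y\<close> at time \<open>s\<close> gives an
  intermediate \<open>\<xi> s\<close> with
  \<open>mass y t - mass y s = k (\<xi> s) s * (Y m s - y)\<close>. Continuity of \<open>Y\<close>
  sends \<open>\<xi> s\<close> to \<open>y\<close>, and joint continuity of \<open>k\<close> then
  gives the limit of the difference quotient.\<close>

lemma Y_t:
  assumes m: "m \<in> {0<..<M}" and t: "t \<in> {0..T}"
  shows "((\<lambda>t. Y m t) has_real_derivative q (Y m t) t / k (Y m t) t) (at t within {0..T})"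
proof -
  define y where "y = Y m t"
  note Yt = Y[OF m t, folded y_def]
  have "\<exists>\<xi>. (\<xi> \<in> closed_segment y (Y m s)) \<and> mass (Y m s) s - mass y s = k \<xi> s * (Y m s - y)"
    if s: "s \<in> {0..T}" for s
  proof -
    note Ys = Y[OF m s]
    have MVT: "\<exists>\<xi>. a < \<xi> \<and> \<xi> < b \<and> mass b s - mass a s = (b - a) * k \<xi> s"
      if "0 < a" "a < b" "b < 1" for a b
      using MVT2[of a b "\<lambda>y. mass y s" "\<lambda>y. k y s"] mass_has_derivative_at s that by auto
    show ?thesis
    proof (cases y "Y m s" rule: linorder_cases)
      case less
      then obtain \<xi> where "y < \<xi>" "\<xi> < Y m s" "mass (Y m s) s - mass y s = (Y m s - y) * k \<xi> s"
        using MVT[of y "Y m s"] Yt(1) Ys(1) by auto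
      then show ?thesis by (intro exI[of _ \<xi>]) (simp add: closed_segment_eq_real_ivl)
    next
      case equal
      then show ?thesis by auto
    next
      case greater
      then obtain \<xi> where "Y m s < \<xi>" "\<xi> < y" "mass y s - mass (Y m s) s = (y - Y m s) * k \<xi> s"
        using MVT[of "Y m s" y] Yt(1) Ys(1) by auto
      then show ?thesis by (intro exI[of _ \<xi>]) (simp add: closed_segment_eq_real_ivl algebra_simps)
    qed
  qed
  then obtain \<xi> where \<xi>: "\<And>s. s \<in> {0..T} \<Longrightarrow> \<xi> s \<in> closed_segment y (Y m s)"
    "\<And>s. s \<in> {0..T} \<Longrightarrow> mass (Y m s) s - mass y s = k (\<xi> s) s * (Y m s - y)"
    by metis
  have ev: "\<forall>\<^sub>F s in at t within {0..T}. s \<in> {0..T} \<and> s \<noteq> t"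
    by (auto simp: eventually_at_filter)
  note evT = eventually_at_within_in[of "{0..T}" t]
  have Ylim: "((\<lambda>s. Y m s) \<longlongrightarrow> y) (at t within {0..T})"
    unfolding y_def by (rule tendsto_Y[OF _ _ m t]) (use m evT in auto)
  have "((\<lambda>s. \<xi> s - y) \<longlongrightarrow> 0) (at t within {0..T})"
  proof (rule Lim_null_comparison)
    show "\<forall>\<^sub>F s in at t within {0..T}. norm (\<xi> s - y) \<le> norm (Y m s - y)"
      using evT by eventually_elim (use \<xi>(1) in \<open>force simp: closed_segment_eq_real_ivl split: if_splits\<close>)
    show "((\<lambda>s. norm (Y m s - y)) \<longlongrightarrow> 0) (at t within {0..T})"
      by (rule tendsto_norm_zero[OF LIM_zero[OF Ylim]])
  qed
  then have "(\<xi> \<longlongrightarrow> y) (at t within {0..T})" by (rule LIM_zero_cancel)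
  then have "((\<lambda>s. (\<xi> s, s)) \<longlongrightarrow> (y, t)) (at t within {0..T})" by (intro tendsto_intros)
  moreover have \<xi>01: "\<xi> s \<in> {0<..<1}" if "s \<in> {0..T}" for s
    using \<xi>(1)[OF that] Y[OF m that] Yt by (auto simp: closed_segment_eq_real_ivl split: if_splits)
  have "\<forall>\<^sub>F s in at t within {0..T}. (\<xi> s, s) \<in> {0..1} \<times> {0..T}"
    using evT by eventually_elim (use \<xi>01 in force)
  ultimately have klim: "((\<lambda>s. k (\<xi> s) s) \<longlongrightarrow> k y t) (at t within {0..T})"
    using continuous_on_tendsto_compose[OF cont_k, of "\<lambda>s. (\<xi> s, s)" "(y, t)"] Yt t by simp
  have "((\<lambda>s. (mass y s - mass y t) / (s - t)) \<longlongrightarrow> - q y t) (at t within {0..T})"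
    using mass_has_derivative_t[of y t] Yt t by (simp add: has_field_derivative_iff)
  then have "((\<lambda>s. - ((mass y s - mass y t) / (s - t)) / k (\<xi> s) s) \<longlongrightarrow> - (- q y t) / k y t) (at t within {0..T})"
    using k_pos[of y t] Yt t by (intro tendsto_intros klim) auto
  moreover have "\<forall>\<^sub>F s in at t within {0..T}.
      - ((mass y s - mass y t) / (s - t)) / k (\<xi> s) s = (Y m s - y) / (s - t)"
    using ev
  proof eventually_elim
    case (elim s)
    have "mass y t - mass y s = k (\<xi> s) s * (Y m s - y)" using \<xi>(2)[of s] Y[OF m, of s] elim Yt by simp
    moreover have "k (\<xi> s) s > 0" using k_pos[of "\<xi> s" s] \<xi>01[of s] elim by auto
    moreover have "- ((mass y s - mass y t) / (s - t)) = (mass y t - mass y s) / (s - t)"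
      by (simp only: minus_divide_left minus_diff_eq)
    ultimately show ?case by simp
  qed
  ultimately have "((\<lambda>s. (Y m s - y) / (s - t)) \<longlongrightarrow> q y t / k y t) (at t within {0..T})"
    by (simp add: tendsto_cong)
  then show ?thesis by (simp add: has_field_derivative_iff y_def)
qed


section \<open>Particle paths\<close>

definition radius :: "real \<Rightarrow> real \<Rightarrow> real" where
  "radius m t = R t * Y m t"

lemma radius_bounds:
  assumes "m \<in> {0<..<M}" "t \<in> {0..T}"
  shows "0 < radius m t" "radius m t < R t" "(radius m t, t) \<in> D"
  using Y(1)[OF assms] R_pos[OF assms(2)] assms(2) by (auto simp: radius_def radial_domain_def)

lemma radius_surj:
  assumes "t \<in> {0..T}" "0 < r" "r < R t"
  obtains m where "m \<in> {0<..<M}" "radius m t = r"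
proof
  have y: "r / R t \<in> {0<..<1}" using assms by auto
  show "mass (r / R t) t \<in> {0<..<M}" using Y_eq[OF y assms(1)] by simp
  show "radius (mass (r / R t) t) t = r" using Y_eq[OF y assms(1)] assms by (simp add: radius_def)
qed

text \<open>The quotient of \<open>q\<close> by \<open>k\<close> is \<open>(w - R' * Y) / R\<close>,
  so the velocity of the rescaled frame cancels: shells of constant enclosed mass move with the
  fluid.\<close>

lemma radius_t:
  assumes m: "m \<in> {0<..<M}" and t: "t \<in> {0..T}"
  shows "((\<lambda>t. radius m t) has_real_derivative w (radius m t) t) (at t within {0..T})"
proof -
  note y = Y(1)[OF m t] and k = k_pos[of "Y m t" t]
  have "((\<lambda>t. radius m t) has_real_derivative R' t * Y m t + q (Y m t) t / k (Y m t) t * R t)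
      (at t within {0..T})"
    unfolding radius_def by (rule DERIV_mult[OF R_t[OF t] Y_t[OF m t]])
  moreover have "R' t * Y m t + q (Y m t) t / k (Y m t) t * R t = w (radius m t) t"
  proof -
    have "g (R t * Y m t) t \<noteq> 0" using y R_pos[OF t] g_pos[OF t, of "R t * Y m t"] by auto
    moreover have "R t \<noteq> 0" "Y m t \<noteq> 0" using y R_pos[OF t] by auto
    ultimately show ?thesis
      unfolding q_def k_def radius_def by (simp add: field_simps power2_eq_square power3_eq_cube)
  qed
  ultimately show ?thesis by simp
qed

lemma radius_m:
  assumes m: "m \<in> {0<..<M}" and t: "t \<in> {0..T}"
  shows "((\<lambda>m. radius m t) has_real_derivative 1 / ((radius m t)\<^sup>2 * g (radius m t) t)) (at m)"
proof -
  note y = Y(1)[OF m t]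
  have "((\<lambda>m. radius m t) has_real_derivative R t * (1 / k (Y m t) t)) (at m)"
    unfolding radius_def by (rule DERIV_cmult[OF Y_m[OF m t]])
  moreover have "R t * (1 / k (Y m t) t) = 1 / ((radius m t)\<^sup>2 * g (radius m t) t)"
    using y R_pos[OF t] by (simp add: k_def radius_def field_simps power2_eq_square power3_eq_cube)
  ultimately show ?thesis by simp
qed

lemma along_particle_path:
  assumes F: "((\<lambda>z. F (fst z) (snd z)) has_derivative (\<lambda>h. Fr * fst h + Ft * snd h))
      (at (radius m t, t) within D)"
    and m: "m \<in> {0<..<M}" and t: "t \<in> {0..T}"
  shows "((\<lambda>t. F (radius m t) t) has_real_derivative Fr * w (radius m t) t + Ft) (at t within {0..T})"
proof -
  have "((\<lambda>t. F (radius m t) t) has_real_derivative Fr * w (radius m t) t + Ft * 1) (at t within {0..T})"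
    by (rule has_real_derivative_along_curve[OF F]) (use radius_t[OF m t] radius_bounds[OF m] in auto)
  then show ?thesis by simp
qed

lemma across_shells:
  assumes F: "((\<lambda>z. F (fst z) (snd z)) has_derivative (\<lambda>h. Fr * fst h + Ft * snd h))
      (at (radius m t, t) within D)"
    and m: "m \<in> {0<..<M}" and t: "t \<in> {0..T}"
  shows "((\<lambda>m. F (radius m t) t) has_real_derivative Fr / ((radius m t)\<^sup>2 * g (radius m t) t)) (at m)"
proof -
  have "((\<lambda>m. F (radius m t) t) has_real_derivative
      Fr * (1 / ((radius m t)\<^sup>2 * g (radius m t) t)) + Ft * 0) (at m within {0<..<M})"
    by (rule has_real_derivative_along_curve[OF F])
      (use has_field_derivative_at_within[OF radius_m[OF m t]] radius_bounds[OF _ t] in auto)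
  then show ?thesis using m at_within_open[of m "{0<..<M}"] by simp
qed

lemma cont_along:
  assumes "continuous_on D (\<lambda>z. F (fst z) (snd z))"
  shows "continuous_on ({0<..<M} \<times> {0..T}) (\<lambda>z. F (radius (fst z) (snd z)) (snd z))"
proof -
  have "continuous_on ({0<..<M} \<times> {0..T}) (\<lambda>z. radius (fst z) (snd z))"
    unfolding radius_def by (intro continuous_on_mult cont_R_snd cont_Y)
  then have "continuous_on ({0<..<M} \<times> {0..T}) (\<lambda>z. (radius (fst z) (snd z), snd z))"
    by (intro continuous_on_Pair continuous_on_snd continuous_on_id)
  then have "continuous_on ({0<..<M} \<times> {0..T})
      (\<lambda>z. F (fst (radius (fst z) (snd z), snd z)) (snd (radius (fst z) (snd z), snd z)))"
    by (rule continuous_on_compose2[OF assms]) (use radius_bounds(3) in auto)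
  then show ?thesis by simp
qed

text \<open>At the centre the density is bounded by \<open>B\<close> while the radius tends to 0; at
  the vacuum the radius is bounded while the density tends to its boundary value 0.\<close>

lemma initial_flux:
  shows "((\<lambda>m. (radius m 0)\<^sup>2 * g (radius m 0) 0 powr \<gamma>) \<longlongrightarrow> 0) (at_right 0)"
    and "((\<lambda>m. (radius m 0)\<^sup>2 * g (radius m 0) 0 powr \<gamma>) \<longlongrightarrow> 0) (at_left M)"
proof -
  have T0: "0 \<in> {0..T}" using T by simp
  have "mass 0 0 < M" using mass_1[OF T0] mass_strict_mono[of 0 1 0] T0 by simp
  then have M: "0 < M" by simp
  have ev0: "\<forall>\<^sub>F m in at_right 0. m \<in> {0<..<M}" and evM: "\<forall>\<^sub>F m in at_left M. m \<in> {0<..<M}"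
    using eventually_at_right_real[OF M] eventually_at_left_real[OF M] by auto
  have Y0: "((\<lambda>m. Y m 0) \<longlongrightarrow> 0) (at_right 0)"
  proof (rule order_tendstoI)
    show "\<forall>\<^sub>F m in at_right 0. a < Y m 0" if "a < 0" for a
      using ev0 by eventually_elim (use Y(1)[OF _ T0] that in force)
    fix a :: real assume a: "0 < a"
    define y where "y = min 1 a"
    have y: "y \<in> {0..1}" "0 < y" "y \<le> a" using a by (auto simp: y_def)
    then have "0 < mass y 0" using mass_strict_mono[of 0 y 0] T0 by simp
    from eventually_at_right_real[OF this]
    show "\<forall>\<^sub>F m in at_right 0. Y m 0 < a"
      using ev0
    proof eventually_elim
      case (elim m)
      then show ?case using Y_less_iff(1)[OF elim(2) y(1) T0] y by auto
    qed
  qed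
  have YM: "((\<lambda>m. Y m 0) \<longlongrightarrow> 1) (at_left M)"
  proof (rule order_tendstoI)
    show "\<forall>\<^sub>F m in at_left M. Y m 0 < a" if "1 < a" for a
      using evM by eventually_elim (use Y(1)[OF _ T0] that in force)
    fix a :: real assume a: "a < 1"
    define y where "y = max 0 a"
    have y: "y \<in> {0..1}" "y < 1" "a \<le> y" using a by (auto simp: y_def)
    then have "mass y 0 < M" using mass_strict_mono[of y 1 0] T0 mass_1[OF T0] by simp
    from eventually_at_left_real[OF this]
    show "\<forall>\<^sub>F m in at_left M. a < Y m 0"
      using evM
    proof eventually_elim
      case (elim m)
      then show ?case using Y_less_iff(2)[OF elim(2) y(1) T0] y by auto
    qed
  qed
  show "((\<lambda>m. (radius m 0)\<^sup>2 * g (radius m 0) 0 powr \<gamma>) \<longlongrightarrow> 0) (at_right 0)"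
  proof (rule Lim_null_comparison)
    show "\<forall>\<^sub>F m in at_right 0. norm ((radius m 0)\<^sup>2 * g (radius m 0) 0 powr \<gamma>)
        \<le> (R 0 * Y m 0)\<^sup>2 * B powr \<gamma>"
      using ev0
    proof eventually_elim
      case (elim m)
      have "g (radius m 0) 0 powr \<gamma> \<le> B powr \<gamma>"
        using radius_bounds[OF elim T0] g_pos[OF T0, of "radius m 0"] g_bound[of "radius m 0" 0] \<gamma>
        by (intro powr_mono2) auto
      then show ?case by (simp add: radius_def mult_left_mono)
    qed
    have "((\<lambda>m. (R 0 * Y m 0)\<^sup>2 * B powr \<gamma>) \<longlongrightarrow> (R 0 * 0)\<^sup>2 * B powr \<gamma>) (at_right 0)"
      by (intro tendsto_intros Y0)
    then show "((\<lambda>m. (R 0 * Y m 0)\<^sup>2 * B powr \<gamma>) \<longlongrightarrow> 0) (at_right 0)" by simp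
  qed
  have "continuous_on {0<..1} (\<lambda>y. g (R 0 * y) 0)"
    by (rule continuous_on_compose2[OF cont_g, where f = "\<lambda>y. (R 0 * y, 0)", simplified])
      (use scaled_in_D[OF _ T0] in \<open>auto intro!: continuous_intros\<close>)
  moreover have "\<forall>\<^sub>F m in at_left M. Y m 0 \<in> {0<..1}"
    using evM by eventually_elim (use Y(1)[OF _ T0] in force)
  ultimately have "((\<lambda>m. g (R 0 * Y m 0) 0) \<longlongrightarrow> g (R 0 * 1) 0) (at_left M)"
    by (intro continuous_on_tendsto_compose[OF _ YM, where f = "\<lambda>y. g (R 0 * y) 0"]) auto
  then have G: "((\<lambda>m. g (radius m 0) 0) \<longlongrightarrow> 0) (at_left M)"
    using g_boundary[OF T0] by (simp add: radius_def)
  \<comment> \<open>At base 0 the power is continuous only from nonnegative values and for a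
    positive exponent, so the sign of the density enters.\<close>
  have "((\<lambda>m. g (radius m 0) 0 powr \<gamma>) \<longlongrightarrow> 0 powr \<gamma>) (at_left M)"
  proof (rule tendsto_powr'[OF G tendsto_const])
    show "0 \<noteq> 0 \<or> 0 < \<gamma> \<and> (\<forall>\<^sub>F m in at_left M. 0 \<le> g (radius m 0) 0)"
      using \<gamma> evM
      by (auto elim!: eventually_mono intro!: less_imp_le[OF g_pos[OF T0]]
          simp del: greaterThanLessThan_iff intro: radius_bounds[OF _ T0])
  qed
  then have "((\<lambda>m. (R 0 * Y m 0)\<^sup>2 * g (radius m 0) 0 powr \<gamma>) \<longlongrightarrow> (R 0 * 1)\<^sup>2 * 0 powr \<gamma>) (at_left M)"
    by (rule tendsto_mult[rotated]) (intro tendsto_intros YM)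
  then show "((\<lambda>m. (radius m 0)\<^sup>2 * g (radius m 0) 0 powr \<gamma>) \<longlongrightarrow> 0) (at_left M)"
    by (simp add: radius_def)
qed

text \<open>The last argument is the label derivative of the pressure by the chain rule. The
  equation for the velocity is the momentum equation divided by the density, since the material
  derivative is the time derivative at fixed label.\<close>

lemma lagrangian_flow:
  "lagrangian_flow \<gamma> T M B radius (\<lambda>m t. w (radius m t) t) (\<lambda>m t. g (radius m t) t)
     (\<lambda>m t. wr (radius m t) t)
     (\<lambda>m t. \<gamma> * g (radius m t) t powr (\<gamma> - 1) * gr (radius m t) t
        / ((radius m t)\<^sup>2 * g (radius m t) t))"
proof (unfold_locales, goal_cases)
  case 1 show ?case by (rule \<gamma>)
next
  case 2 then show ?case by (rule radius_bounds)
next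
  case (3 m t) then show ?case by (intro g_pos radius_bounds)
next
  case 4 then show ?case by (intro w_bound radius_bounds)
next
  case 5 then show ?case by (intro w_le_r radius_bounds)
next
  case 6 then show ?case by (intro wr_bound radius_bounds)
next
  case 7 then show ?case by (rule radius_t)
next
  case (8 m t)
  note b = radius_bounds[OF 8]
  have g: "g (radius m t) t > 0" using g_pos 8 b by blast
  have "((\<lambda>t. w (radius m t) t) has_real_derivative wr (radius m t) t * w (radius m t) t + wt (radius m t) t)
      (at t within {0..T})"
    by (rule along_particle_path[OF w_deriv[OF b(3)] 8])
  moreover have "wr (radius m t) t * w (radius m t) t + wt (radius m t) t =
      - ((radius m t)\<^sup>2 * (\<gamma> * g (radius m t) t powr (\<gamma> - 1) * gr (radius m t) t
        / ((radius m t)\<^sup>2 * g (radius m t) t)))"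
    using momentum_equation[OF 8(2) b(1,2)] b(1) g by (simp add: field_simps)
  ultimately show ?case by simp
next
  case (9 m t)
  note b = radius_bounds[OF 9]
  have "((\<lambda>t. g (radius m t) t) has_real_derivative gr (radius m t) t * w (radius m t) t + gt (radius m t) t)
      (at t within {0..T})"
    by (rule along_particle_path[OF g_deriv[OF b(3)] 9])
  then show ?case
    by (rule DERIV_cong) (use continuity_equation[OF 9(2) b(1,2)] in \<open>simp add: algebra_simps\<close>)
next
  case 10 then show ?case by (rule radius_m)
next
  case (11 m t) show ?case by (rule across_shells[OF w_deriv[OF radius_bounds(3)[OF 11]] 11])
next
  case (12 m t)
  note b = radius_bounds[OF 12]
  have g: "g (radius m t) t > 0" using g_pos 12 b by blast
  have "((\<lambda>m. g (radius m t) t powr \<gamma>) has_real_derivative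
      g (radius m t) t powr \<gamma> * (0 * ln (g (radius m t) t)
       + gr (radius m t) t / ((radius m t)\<^sup>2 * g (radius m t) t) * \<gamma> / g (radius m t) t)) (at m)"
    by (rule DERIV_powr[OF across_shells[OF g_deriv[OF b(3)] 12] g DERIV_const])
  then show ?case
    by (rule DERIV_cong) (use g b(1) in \<open>simp add: powr_diff field_simps\<close>)
next
  case 13 show ?case unfolding radius_def by (intro continuous_on_mult cont_R_snd cont_Y)
next
  case 14 show ?case by (rule cont_along[OF cont_w])
next
  case 15 show ?case by (rule cont_along[OF cont_g])
next
  case 16 show ?case by (rule cont_along[OF cont_wr])
next
  case 17
  have "continuous_on ({0<..<M} \<times> {0..T}) (\<lambda>z. radius (fst z) (snd z))"
    unfolding radius_def by (intro continuous_on_mult cont_R_snd cont_Y)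
  moreover have "radius (fst z) (snd z) \<noteq> 0 \<and> g (radius (fst z) (snd z)) (snd z) \<noteq> 0"
    if "z \<in> {0<..<M} \<times> {0..T}" for z
  proof -
    have z: "fst z \<in> {0<..<M}" "snd z \<in> {0..T}" using that by (auto simp: mem_Times_iff)
    show ?thesis using radius_bounds[OF z] g_pos[OF z(2)] by force
  qed
  ultimately show ?case
    by (intro continuous_intros cont_along[OF cont_g] cont_along[OF cont_gr]) fastforce+
next
  case 18 show ?case by (rule initial_flux)
next
  case 19 show ?case by (rule initial_flux)
qed

end

section \<open>Uniqueness for radial flows\<close>

theorem radial_flow_uniqueness:
  assumes 1: "radial_flow \<gamma> T B R\<^sub>1 R\<^sub>1' g\<^sub>1 w\<^sub>1 gr\<^sub>1 gt\<^sub>1 wr\<^sub>1 wt\<^sub>1"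
    and 2: "radial_flow \<gamma> T B R\<^sub>2 R\<^sub>2' g\<^sub>2 w\<^sub>2 gr\<^sub>2 gt\<^sub>2 wr\<^sub>2 wt\<^sub>2"
    and R0: "R\<^sub>1 0 = R\<^sub>2 0"
    and init: "\<And>r. 0 < r \<Longrightarrow> r \<le> R\<^sub>1 0 \<Longrightarrow> g\<^sub>1 r 0 = g\<^sub>2 r 0 \<and> w\<^sub>1 r 0 = w\<^sub>2 r 0"
    and t: "t \<in> {0..T}"
  shows "R\<^sub>1 t = R\<^sub>2 t" "\<And>r. 0 < r \<Longrightarrow> r \<le> R\<^sub>1 t \<Longrightarrow> g\<^sub>1 r t = g\<^sub>2 r t \<and> w\<^sub>1 r t = w\<^sub>2 r t"
proof -
  interpret F1: radial_flow \<gamma> T B R\<^sub>1 R\<^sub>1' g\<^sub>1 w\<^sub>1 gr\<^sub>1 gt\<^sub>1 wr\<^sub>1 wt\<^sub>1 by (rule 1)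
  interpret F2: radial_flow \<gamma> T B R\<^sub>2 R\<^sub>2' g\<^sub>2 w\<^sub>2 gr\<^sub>2 gt\<^sub>2 wr\<^sub>2 wt\<^sub>2 by (rule 2)
  have T0: "0 \<in> {0..T}" using F1.T by simp
  \<comment> \<open>The labels have to be matched only at time 0: equal data give the same mass
    function, total mass and initial radii.\<close>
  have k: "F1.k z 0 = F2.k z 0" if "z \<in> {0..1}" for z
  proof (cases "z = 0")
    case False
    then have "0 < R\<^sub>1 0 * z" "R\<^sub>1 0 * z \<le> R\<^sub>1 0" using that F1.R_pos[OF T0] by (auto simp: mult_le_cancel_left1)
    then show ?thesis using init[of "R\<^sub>1 0 * z"] R0 by (simp add: F1.k_def F2.k_def)
  qed (simp add: F1.k_def F2.k_def)
  have mass: "F1.mass y 0 = F2.mass y 0" if "y \<in> {0..1}" for y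
    unfolding F1.mass_def F2.mass_def by (rule integral_cong) (use k that in auto)
  have M: "F1.M = F2.M" by (simp add: F1.M_def F2.M_def mass)
  have Y: "F1.Y m 0 = F2.Y m 0" if "m \<in> {0<..<F1.M}" for m
  proof (rule F2.mass_inj[of _ 0])
    have "F2.mass (F1.Y m 0) 0 = F1.mass (F1.Y m 0) 0" using F1.Y[OF that T0] mass by auto
    then show "F2.mass (F1.Y m 0) 0 = F2.mass (F2.Y m 0) 0"
      using F1.Y[OF that T0] F2.Y[OF that[unfolded M] T0] by simp
    show "F1.Y m 0 \<in> {0..1}" "F2.Y m 0 \<in> {0..1}"
      using F1.Y[OF that T0] F2.Y[OF that[unfolded M] T0] by auto
  qed (rule T0)
  have rad: "F1.radius m 0 = F2.radius m 0" if "m \<in> {0<..<F1.M}" for m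
    using Y[OF that] R0 by (simp add: F1.radius_def F2.radius_def)
  have "lagrangian_flow_pair \<gamma> T F1.M B
      F1.radius (\<lambda>m t. w\<^sub>1 (F1.radius m t) t) (\<lambda>m t. g\<^sub>1 (F1.radius m t) t) (\<lambda>m t. wr\<^sub>1 (F1.radius m t) t)
      (\<lambda>m t. \<gamma> * g\<^sub>1 (F1.radius m t) t powr (\<gamma> - 1) * gr\<^sub>1 (F1.radius m t) t
        / ((F1.radius m t)\<^sup>2 * g\<^sub>1 (F1.radius m t) t))
      F2.radius (\<lambda>m t. w\<^sub>2 (F2.radius m t) t) (\<lambda>m t. g\<^sub>2 (F2.radius m t) t) (\<lambda>m t. wr\<^sub>2 (F2.radius m t) t)
      (\<lambda>m t. \<gamma> * g\<^sub>2 (F2.radius m t) t powr (\<gamma> - 1) * gr\<^sub>2 (F2.radius m t) t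
        / ((F2.radius m t)\<^sup>2 * g\<^sub>2 (F2.radius m t) t))"
  proof (intro lagrangian_flow_pair.intro lagrangian_flow_pair_axioms.intro
      F1.lagrangian_flow F2.lagrangian_flow[folded M])
    fix m assume m: "m \<in> {0<..<F1.M}"
    note b = F1.radius_bounds[OF m T0]
    show "F1.radius m 0 = F2.radius m 0" by (rule rad[OF m])
    show "w\<^sub>1 (F1.radius m 0) 0 = w\<^sub>2 (F2.radius m 0) 0" "g\<^sub>1 (F1.radius m 0) 0 = g\<^sub>2 (F2.radius m 0) 0"
      using init[of "F1.radius m 0"] b rad[OF m] by auto
  qed
  note L = lagrangian_flow_pair.lagrangian_uniqueness[OF this F1.T _ t]
  \<comment> \<open>Otherwise the sphere of radius \<open>R\<^sub>1 t\<close> would be a shell of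
    the second flow. The shell of the first flow with the same label would have the same radius, yet
    all its shells lie strictly inside \<open>R\<^sub>1 t\<close>.\<close>
  have "\<not> R\<^sub>1 t < R\<^sub>2 t"
  proof
    assume "R\<^sub>1 t < R\<^sub>2 t"
    then obtain m where "m \<in> {0<..<F2.M}" "F2.radius m t = R\<^sub>1 t"
      using F2.radius_surj[OF t F1.R_pos[OF t]] by blast
    then show False using L(1)[of m] F1.radius_bounds(2)[of m t] M t by simp
  qed
  moreover have "\<not> R\<^sub>2 t < R\<^sub>1 t"
  proof
    assume "R\<^sub>2 t < R\<^sub>1 t"
    then obtain m where "m \<in> {0<..<F1.M}" "F1.radius m t = R\<^sub>2 t"
      using F1.radius_surj[OF t F2.R_pos[OF t]] by blast
    then show False using L(1)[of m] F2.radius_bounds(2)[of m t] M t by simp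
  qed
  ultimately show eqR: "R\<^sub>1 t = R\<^sub>2 t" by simp
  have interior: "g\<^sub>1 r t = g\<^sub>2 r t \<and> w\<^sub>1 r t = w\<^sub>2 r t" if r: "0 < r" "r < R\<^sub>1 t" for r
  proof -
    obtain m where m: "m \<in> {0<..<F1.M}" "F1.radius m t = r" using F1.radius_surj[OF t r] by blast
    show ?thesis using L[OF m(1)] m(2) by simp
  qed
  \<comment> \<open>Shells cover only the interior; the velocity at the free boundary is obtained as
    a limit from inside.\<close>
  have "w\<^sub>1 (R\<^sub>1 t) t = w\<^sub>2 (R\<^sub>1 t) t"
  proof -
    have Rp: "R\<^sub>1 t / 2 < R\<^sub>1 t" using F1.R_pos[OF t] by simp
    have c: "continuous_on {R\<^sub>1 t / 2..R\<^sub>1 t} (\<lambda>r. F r t)"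
      if "continuous_on (radial_domain T R) (\<lambda>z. F (fst z) (snd z))" "R t = R\<^sub>1 t" for F :: "real \<Rightarrow> real \<Rightarrow> real" and R
      by (rule continuous_on_compose2[OF that(1), where f = "\<lambda>r. (r, t)", simplified])
        (use t that(2) Rp in \<open>auto intro!: continuous_intros simp: radial_domain_def\<close>)
    have lim: "(f \<longlongrightarrow> f (R\<^sub>1 t)) (at_left (R\<^sub>1 t))"
      if "continuous_on {R\<^sub>1 t / 2..R\<^sub>1 t} f" for f :: "real \<Rightarrow> real"
    proof -
      have "(f \<longlongrightarrow> f (R\<^sub>1 t)) (at (R\<^sub>1 t) within {R\<^sub>1 t / 2..R\<^sub>1 t})"
        using that F1.R_pos[OF t] unfolding continuous_on by auto
      then show ?thesis by (simp only: at_within_Icc_at_left[OF Rp])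
    qed
    have "\<forall>\<^sub>F r in at_left (R\<^sub>1 t). w\<^sub>1 r t = w\<^sub>2 r t"
      using eventually_at_left_real[OF F1.R_pos[OF t]] by eventually_elim (use interior in auto)
    then have "((\<lambda>r. w\<^sub>2 r t) \<longlongrightarrow> w\<^sub>1 (R\<^sub>1 t) t) (at_left (R\<^sub>1 t))"
      using lim[OF c[OF F1.cont_w refl]] by (simp add: tendsto_cong)
    then show ?thesis
      using tendsto_unique[OF trivial_limit_at_left_real lim[OF c[OF F2.cont_w eqR[symmetric]]]] by simp
  qed
  then show "g\<^sub>1 r t = g\<^sub>2 r t \<and> w\<^sub>1 r t = w\<^sub>2 r t" if "0 < r" "r \<le> R\<^sub>1 t" for r
    using interior[of r] that F1.g_boundary[OF t] F2.g_boundary[OF t] eqR by (cases "r = R\<^sub>1 t") auto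
qed

subsection \<open>Reduction to the radial problem\<close>

abbreviation e\<^sub>1 :: point where
  "e\<^sub>1 \<equiv> axis 1 1"

lemma partial_eq: "(f has_derivative f') (at x) \<Longrightarrow> partial i f x = f' (axis i 1)"
  unfolding partial_def by (metis frechet_derivative_at)

lemma axis_nth_simps [simp]:
  "axis i (a :: real) $ i = a" "i \<noteq> j \<Longrightarrow> axis i (a :: real) $ j = 0"
  by (simp_all add: axis_def)

text \<open>Names the derivatives that the regularity conditions only assert to exist, with one
  common bound \<open>B\<close>.\<close>

locale regular_euler_flow =
  fixes \<gamma> T R\<^sub>0 :: real and \<rho>\<^sub>0 :: "point \<Rightarrow> real" and u\<^sub>0 :: "point \<Rightarrow> point"
    and \<rho> :: "point \<Rightarrow> real \<Rightarrow> real" and u :: "point \<Rightarrow> real \<Rightarrow> point" and R R' :: "real \<Rightarrow> real"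
    and d\<rho> :: "point \<times> real \<Rightarrow> (point \<times> real) \<Rightarrow>\<^sub>L real" and du :: "point \<times> real \<Rightarrow> (point \<times> real) \<Rightarrow>\<^sub>L point"
    and B :: real
  assumes \<gamma>: "\<gamma> > 1" and T: "T > 0"
    and solution: "euler_fb_solution \<gamma> T R\<^sub>0 \<rho>\<^sub>0 u\<^sub>0 \<rho> u R"
    and R_t: "\<And>t. t \<in> {0..T} \<Longrightarrow> (R has_real_derivative R' t) (at t within {0..T})"
    and cont_R': "continuous_on {0..T} R'"
    and \<rho>_deriv: "\<And>p. p \<in> punctured_tube T R \<Longrightarrow>
      ((\<lambda>(x, t). \<rho> x t) has_derivative blinfun_apply (d\<rho> p)) (at p within punctured_tube T R)"
    and u_deriv: "\<And>p. p \<in> punctured_tube T R \<Longrightarrow>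
      ((\<lambda>(x, t). u x t) has_derivative blinfun_apply (du p)) (at p within punctured_tube T R)"
    and cont_d\<rho>: "continuous_on (punctured_tube T R) d\<rho>"
    and cont_du: "continuous_on (punctured_tube T R) du"
    and \<rho>_bound: "\<And>x t. (x, t) \<in> punctured_tube T R \<Longrightarrow> norm (\<rho> x t) \<le> B"
    and u_bound: "\<And>x t. (x, t) \<in> punctured_tube T R \<Longrightarrow> norm (u x t) \<le> B"
    and d\<rho>_bound: "\<And>p. p \<in> punctured_tube T R \<Longrightarrow> norm (d\<rho> p) \<le> B"
    and du_bound: "\<And>p. p \<in> punctured_tube T R \<Longrightarrow> norm (du p) \<le> B"
begin

text \<open>Reading the profiles off along a ray makes them compositions with a linear map, so they
  inherit the differentiability of the fields; the profiles in the definition of radial symmetry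
  come without any.\<close>

abbreviation g :: "real \<Rightarrow> real \<Rightarrow> real" where "g r t \<equiv> \<rho> (r *\<^sub>R e\<^sub>1) t"
abbreviation w :: "real \<Rightarrow> real \<Rightarrow> real" where "w r t \<equiv> u (r *\<^sub>R e\<^sub>1) t $ 1"
abbreviation gr :: "real \<Rightarrow> real \<Rightarrow> real" where "gr r t \<equiv> d\<rho> (r *\<^sub>R e\<^sub>1, t) (e\<^sub>1, 0)"
abbreviation gt :: "real \<Rightarrow> real \<Rightarrow> real" where "gt r t \<equiv> d\<rho> (r *\<^sub>R e\<^sub>1, t) (0, 1)"
abbreviation wr :: "real \<Rightarrow> real \<Rightarrow> real" where "wr r t \<equiv> du (r *\<^sub>R e\<^sub>1, t) (e\<^sub>1, 0) $ 1"
abbreviation wt :: "real \<Rightarrow> real \<Rightarrow> real" where "wt r t \<equiv> du (r *\<^sub>R e\<^sub>1, t) (0, 1) $ 1"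

lemmas solution_at = solution[unfolded euler_fb_solution_def, THEN conjunct2, THEN conjunct2, THEN bspec]

lemma R_pos: "t \<in> {0..T} \<Longrightarrow> R t > 0"
  using solution_at by blast

lemma ray_in_tube: "(r, t) \<in> radial_domain T R \<Longrightarrow> (r *\<^sub>R e\<^sub>1, t) \<in> punctured_tube T R"
  by (auto simp: radial_domain_def punctured_tube_def)

lemma \<rho>_radial:
  assumes "t \<in> {0..T}" "norm x \<le> R t"
  shows "\<rho> x t = g (norm x) t"
proof -
  obtain h where "\<And>y. y \<in> cball 0 (R t) \<Longrightarrow> \<rho> y t = h (norm y)"
    using solution_at[OF assms(1), THEN conjunct2, THEN conjunct1] unfolding radial_scalar_on_def by blast
  then show ?thesis using assms by simp
qed

lemma u_radial:
  assumes "t \<in> {0..T}" "0 < norm x" "norm x \<le> R t"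
  shows "u x t = w (norm x) t *\<^sub>R (x /\<^sub>R norm x)"
proof -
  obtain h where h: "\<And>y. y \<in> cball 0 (R t) - {0} \<Longrightarrow> u y t = h (norm y) *\<^sub>R (y /\<^sub>R norm y)"
    using solution_at[OF assms(1), THEN conjunct2, THEN conjunct2, THEN conjunct1]
    unfolding radial_vector_on_def by blast
  have n: "norm (norm x *\<^sub>R e\<^sub>1) = norm x" by simp
  then have "norm x *\<^sub>R e\<^sub>1 \<in> cball 0 (R t) - {0}" using assms by force
  from h[OF this] have "u (norm x *\<^sub>R e\<^sub>1) t = h (norm x) *\<^sub>R e\<^sub>1"
    unfolding n using assms(2) by simp
  then have "w (norm x) t = h (norm x)" by simp
  moreover have "x \<in> cball 0 (R t) - {0}" using assms by simp
  ultimately show ?thesis using h by simp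
qed

lemma u_ray:
  assumes "t \<in> {0..T}" "0 < r" "r \<le> R t"
  shows "u (r *\<^sub>R e\<^sub>1) t = w r t *\<^sub>R e\<^sub>1"
  using u_radial[of t "r *\<^sub>R e\<^sub>1"] assms by simp

text \<open>
  A radial field is constant along spheres up to rotation; differentiating along a great circle
  yields its tangential derivative.
\<close>

lemma du_tangential:
  assumes t: "t \<in> {0..T}" and r: "0 < r" "r \<le> R t" and j: "j \<noteq> 1"
  shows "du (r *\<^sub>R e\<^sub>1, t) (axis j 1, 0) = (w r t / r) *\<^sub>R axis j 1"
proof -
  define c :: "real \<Rightarrow> point" where "c \<theta> = (r * cos \<theta>) *\<^sub>R e\<^sub>1 + (r * sin \<theta>) *\<^sub>R axis j 1" for \<theta>
  have "c \<theta> \<bullet> c \<theta> = r\<^sup>2 * ((cos \<theta>)\<^sup>2 + (sin \<theta>)\<^sup>2)" for \<theta>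
    using j unfolding power2_eq_square distrib_left
    by (simp add: c_def inner_add_left inner_add_right inner_axis_axis mult_ac)
  then have norm_c: "norm (c \<theta>) = r" for \<theta>
    using r by (simp add: norm_eq_sqrt_inner)
  have tube: "(c \<theta>, t) \<in> punctured_tube T R" for \<theta>
  proof -
    have "c \<theta> \<noteq> 0" using norm_c[of \<theta>] r by auto
    then show ?thesis using t r norm_c[of \<theta>] by (simp add: punctured_tube_def)
  qed
  have c0: "c 0 = r *\<^sub>R e\<^sub>1" by (simp add: c_def)
  have "((\<lambda>\<theta>. (c \<theta>, t)) has_vector_derivative (r *\<^sub>R axis j 1, 0)) (at 0)"
    unfolding c_def by (auto intro!: derivative_eq_intros has_vector_derivative_Pair)
  then have "((\<lambda>\<theta>. case (c \<theta>, t) of (x, t) \<Rightarrow> u x t) has_derivative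
      (\<lambda>h. du (c 0, t) (h *\<^sub>R (r *\<^sub>R axis j 1, 0)))) (at 0 within UNIV)"
    unfolding has_vector_derivative_def
    by (intro has_derivative_in_compose2[OF u_deriv, where f = "\<lambda>\<theta>. (c \<theta>, t)"]) (use tube in auto)
  then have 1: "((\<lambda>\<theta>. u (c \<theta>) t) has_vector_derivative du (r *\<^sub>R e\<^sub>1, t) (r *\<^sub>R axis j 1, 0)) (at 0)"
    by (simp add: has_vector_derivative_def c0 blinfun.scaleR_right flip: scaleR_Pair)
  have "u (c \<theta>) t = w r t *\<^sub>R (cos \<theta> *\<^sub>R e\<^sub>1 + sin \<theta> *\<^sub>R axis j 1)" for \<theta>
  proof -
    have "c \<theta> /\<^sub>R r = cos \<theta> *\<^sub>R e\<^sub>1 + sin \<theta> *\<^sub>R axis j 1"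
      using r by (simp add: c_def scaleR_add_right flip: mult.assoc)
    then show ?thesis using u_radial[OF t, of "c \<theta>"] r unfolding norm_c by simp
  qed
  then have "((\<lambda>\<theta>. u (c \<theta>) t) has_vector_derivative w r t *\<^sub>R axis j 1) (at 0)"
    by (auto intro!: derivative_eq_intros)
  from vector_derivative_unique_at[OF 1 this]
  have "r *\<^sub>R du (r *\<^sub>R e\<^sub>1, t) (axis j 1, 0) = w r t *\<^sub>R axis j 1"
    using blinfun.scaleR_right[of "du (r *\<^sub>R e\<^sub>1, t)" r "(axis j 1, 0)"] by simp
  then have "(1 / r) *\<^sub>R (r *\<^sub>R du (r *\<^sub>R e\<^sub>1, t) (axis j 1, 0)) = (1 / r) *\<^sub>R (w r t *\<^sub>R axis j 1)"
    by simp
  then show ?thesis using r by simp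
qed

section \<open>Restricting derivatives to slices and to a ray\<close>

lemma spatial_derivative:
  fixes f :: "point \<Rightarrow> real \<Rightarrow> 'b::real_normed_vector" and df :: "point \<times> real \<Rightarrow> (point \<times> real) \<Rightarrow>\<^sub>L 'b"
  assumes f: "\<And>p. p \<in> punctured_tube T R \<Longrightarrow>
      ((\<lambda>(x, t). f x t) has_derivative blinfun_apply (df p)) (at p within punctured_tube T R)"
    and t: "t \<in> {0..T}" and x: "0 < norm x" "norm x < R t"
  shows "((\<lambda>y. f y t) has_derivative (\<lambda>h. df (x, t) (h, 0))) (at x)"
proof -
  define S where "S = {y::point. 0 < norm y} \<inter> {y. norm y < R t}"
  have "open S" unfolding S_def
    by (intro open_Int open_Collect_less continuous_intros)
  moreover have "((\<lambda>y. case (y, t) of (x, t) \<Rightarrow> f x t) has_derivative (\<lambda>h. df (x, t) (h, 0))) (at x within S)"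
    by (rule has_derivative_in_compose2[OF f, where f = "\<lambda>y. (y, t)"])
      (use t x in \<open>auto simp: S_def punctured_tube_def intro!: derivative_eq_intros\<close>)
  ultimately show ?thesis using at_within_open[of x S] x by (simp add: S_def)
qed

text \<open>The tube is not a product, so \<open>x\<close> may leave it at distant times. Since
  \<open>norm x < R t\<close> and \<open>R\<close> is continuous, it stays inside for times near
  \<open>t\<close>, and the two filters at \<open>t\<close> agree.\<close>

lemma temporal_derivative:
  fixes f :: "point \<Rightarrow> real \<Rightarrow> 'b::real_normed_vector" and df :: "point \<times> real \<Rightarrow> (point \<times> real) \<Rightarrow>\<^sub>L 'b"
  assumes f: "\<And>p. p \<in> punctured_tube T R \<Longrightarrow>
      ((\<lambda>(x, t). f x t) has_derivative blinfun_apply (df p)) (at p within punctured_tube T R)"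
    and t: "t \<in> {0..T}" and x: "0 < norm x" "norm x < R t"
  shows "((\<lambda>s. f x s) has_vector_derivative df (x, t) (0, 1)) (at t within {0..T})"
proof -
  define S where "S = {s \<in> {0..T}. norm x \<le> R s}"
  have "continuous_on {0..T} R" using R_t by (rule DERIV_continuous_on)
  from this[unfolded continuous_on_iff, rule_format, OF t, of "R t - norm x"]
  obtain d where d: "d > 0" "\<And>s. s \<in> {0..T} \<Longrightarrow> dist s t < d \<Longrightarrow> dist (R s) (R t) < R t - norm x"
    using x(2) by auto
  have "at t within {0..T} = at t within S"
  proof (rule at_within_nhd[where S = "ball t d"])
    show "{0..T} \<inter> ball t d - {t} = S \<inter> ball t d - {t}"
      using d(2) by (force simp: S_def dist_commute dist_real_def)
  qed (use d in auto)
  moreover have "((\<lambda>s. case (x, s) of (x, t) \<Rightarrow> f x t) has_derivative (\<lambda>h. df (x, t) (0, h))) (at t within S)"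
    by (rule has_derivative_in_compose2[OF f, where f = "\<lambda>s. (x, s)"])
      (use t x in \<open>auto simp: S_def punctured_tube_def intro!: derivative_eq_intros\<close>)
  moreover have "(\<lambda>h. df (x, t) (0, h)) = (\<lambda>h. h *\<^sub>R df (x, t) (0, 1))"
  proof
    fix h :: real
    have "(0 :: point, h) = h *\<^sub>R (0, 1)" by simp
    then show "df (x, t) (0, h) = h *\<^sub>R df (x, t) (0, 1)" by (simp only: blinfun.scaleR_right)
  qed
  ultimately show ?thesis unfolding has_vector_derivative_def by simp
qed

text \<open>As \<open>T\<close> is positive, no time in the interval is isolated, so the derivative
  relative to it is unique.\<close>

lemma time_deriv_eq:
  "t \<in> {0..T} \<Longrightarrow> (f has_vector_derivative d) (at t within {0..T}) \<Longrightarrow> time_deriv T f t = d"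
  for f :: "real \<Rightarrow> 'b::euclidean_space"
  unfolding time_deriv_def using T by (intro vector_derivative_within_closed_interval)

lemma ray_derivative:
  fixes f :: "point \<Rightarrow> real \<Rightarrow> 'b::real_normed_vector" and df :: "point \<times> real \<Rightarrow> (point \<times> real) \<Rightarrow>\<^sub>L 'b"
  assumes f: "\<And>p. p \<in> punctured_tube T R \<Longrightarrow>
      ((\<lambda>(x, t). f x t) has_derivative blinfun_apply (df p)) (at p within punctured_tube T R)"
    and z: "(r, t) \<in> radial_domain T R"
  shows "((\<lambda>z. f (fst z *\<^sub>R e\<^sub>1) (snd z)) has_derivative
      (\<lambda>h. fst h *\<^sub>R df (r *\<^sub>R e\<^sub>1, t) (e\<^sub>1, 0) + snd h *\<^sub>R df (r *\<^sub>R e\<^sub>1, t) (0, 1)))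
      (at (r, t) within radial_domain T R)"
proof -
  have "((\<lambda>z. case (fst z *\<^sub>R e\<^sub>1, snd z) of (x, t) \<Rightarrow> f x t) has_derivative
      (\<lambda>h. df (fst (r, t) *\<^sub>R e\<^sub>1, snd (r, t)) (fst h *\<^sub>R e\<^sub>1, snd h))) (at (r, t) within radial_domain T R)"
    by (rule has_derivative_in_compose2[OF f, where f = "\<lambda>z. (fst z *\<^sub>R e\<^sub>1, snd z)"])
      (use z ray_in_tube in \<open>auto intro!: derivative_eq_intros\<close>)
  moreover have "df p (a *\<^sub>R e\<^sub>1, b) = a *\<^sub>R df p (e\<^sub>1, 0) + b *\<^sub>R df p (0, 1)" for p a b
  proof -
    have "(a *\<^sub>R e\<^sub>1, b) = a *\<^sub>R (e\<^sub>1, 0) + b *\<^sub>R (0, 1)" by simp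
    then show ?thesis by (simp only: blinfun.add_right blinfun.scaleR_right)
  qed
  ultimately show ?thesis by simp
qed

lemma cont_ray:
  assumes "continuous_on (punctured_tube T R) df"
  shows "continuous_on (radial_domain T R) (\<lambda>z. blinfun_apply (df (fst z *\<^sub>R e\<^sub>1, snd z)) h)"
  by (intro continuous_intros continuous_on_compose2[OF assms]) (use ray_in_tube in auto)

text \<open>The term \<open>2 * (w r t / r)\<close> is the sum of the two tangential derivatives
  from \<open>du_tangential\<close>. A general factor \<open>\<phi>\<close> serves both equations:
  it is the density for mass and the density times the first velocity component for
  momentum.\<close>

lemma divergence_radial:
  assumes t: "t \<in> {0..T}" and r: "0 < r" "r < R t"
    and \<phi>: "(\<phi> has_derivative \<phi>') (at (r *\<^sub>R e\<^sub>1))"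
  shows "divergence (\<lambda>y. \<phi> y *\<^sub>R u y t) (r *\<^sub>R e\<^sub>1)
    = \<phi>' e\<^sub>1 * w r t + \<phi> (r *\<^sub>R e\<^sub>1) * (wr r t + 2 * (w r t / r))"
proof -
  have u': "((\<lambda>y. u y t) has_derivative (\<lambda>h. du (r *\<^sub>R e\<^sub>1, t) (h, 0))) (at (r *\<^sub>R e\<^sub>1))"
    by (rule spatial_derivative[OF u_deriv t]) (use r in auto)
  have "partial j (\<lambda>y. (\<phi> y *\<^sub>R u y t) $ j) (r *\<^sub>R e\<^sub>1)
      = \<phi> (r *\<^sub>R e\<^sub>1) * du (r *\<^sub>R e\<^sub>1, t) (axis j 1, 0) $ j + \<phi>' (axis j 1) * u (r *\<^sub>R e\<^sub>1) t $ j" for j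
  proof (rule partial_eq)
    have "((\<lambda>y. u y t $ j) has_derivative (\<lambda>h. du (r *\<^sub>R e\<^sub>1, t) (h, 0) $ j)) (at (r *\<^sub>R e\<^sub>1))"
      by (rule bounded_linear.has_derivative[OF bounded_linear_vec_nth u'])
    then show "((\<lambda>y. (\<phi> y *\<^sub>R u y t) $ j) has_derivative
        (\<lambda>h. \<phi> (r *\<^sub>R e\<^sub>1) * du (r *\<^sub>R e\<^sub>1, t) (h, 0) $ j + \<phi>' h * u (r *\<^sub>R e\<^sub>1) t $ j)) (at (r *\<^sub>R e\<^sub>1))"
      using has_derivative_mult[OF \<phi>] by simp
  qed
  moreover have "u (r *\<^sub>R e\<^sub>1) t $ j = 0" if "j \<noteq> 1" for j
    by (subst u_ray[OF t r(1)]) (use r that in auto)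
  ultimately show ?thesis
    unfolding divergence_def sum_3
    using du_tangential[OF t r(1), of 2] du_tangential[OF t r(1), of 3] r
    by (simp add: algebra_simps)
qed

lemma radial_continuity_equation:
  assumes t: "t \<in> {0..T}" and r: "0 < r" "r < R t"
  shows "gt r t = - w r t * gr r t - g r t * (wr r t + 2 * (w r t / r))"
proof -
  have n: "0 < norm (r *\<^sub>R e\<^sub>1)" "norm (r *\<^sub>R e\<^sub>1) < R t" using r by auto
  have "time_deriv T (\<lambda>s. \<rho> (r *\<^sub>R e\<^sub>1) s) t + divergence (\<lambda>y. \<rho> y t *\<^sub>R u y t) (r *\<^sub>R e\<^sub>1) = 0"
    using solution_at[OF t] n by blast
  moreover have "time_deriv T (\<lambda>s. \<rho> (r *\<^sub>R e\<^sub>1) s) t = gt r t"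
    by (rule time_deriv_eq[OF t temporal_derivative[OF \<rho>_deriv t n]])
  ultimately show ?thesis
    using divergence_radial[OF t r spatial_derivative[OF \<rho>_deriv t n]] by (simp add: algebra_simps)
qed

text \<open>On the ray the first component carries the radial balance, and the first row of the
  tensor is \<open>\<rho>\<close> times \<open>u $ 1\<close> times \<open>u\<close>. Inserting the
  continuity equation for \<open>gt\<close> removes the conservative form.\<close>

lemma radial_momentum_equation:
  assumes t: "t \<in> {0..T}" and r: "0 < r" "r < R t"
  shows "g r t * (wt r t + w r t * wr r t) + \<gamma> * g r t powr (\<gamma> - 1) * gr r t = 0"
proof -
  let ?x = "r *\<^sub>R e\<^sub>1"
  have n: "0 < norm ?x" "norm ?x < R t" using r by auto
  have pos: "0 < \<rho> ?x t" using solution_at[OF t] n by blast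
  note \<rho>' = spatial_derivative[OF \<rho>_deriv t n] and u' = spatial_derivative[OF u_deriv t n]
  have eq: "time_deriv T (\<lambda>s. \<rho> ?x s *\<^sub>R u ?x s) t
      + tensor_divergence (\<lambda>y. \<rho> y t *\<^sub>R outer (u y t) (u y t)) ?x
      + gradient (\<lambda>y. \<rho> y t powr \<gamma>) ?x = 0"
    using solution_at[OF t] n by blast
  have "time_deriv T (\<lambda>s. \<rho> ?x s *\<^sub>R u ?x s) t = \<rho> ?x t *\<^sub>R du (?x, t) (0, 1) + gt r t *\<^sub>R u ?x t"
    by (rule time_deriv_eq[OF t has_vector_derivative_scaleR])
      (use temporal_derivative[OF \<rho>_deriv t n] temporal_derivative[OF u_deriv t n]
       in \<open>simp_all add: has_real_derivative_iff_has_vector_derivative\<close>)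
  then have 1: "time_deriv T (\<lambda>s. \<rho> ?x s *\<^sub>R u ?x s) t $ 1 = g r t * wt r t + gt r t * w r t" by simp
  have u1: "((\<lambda>y. u y t $ 1) has_derivative (\<lambda>h. du (?x, t) (h, 0) $ 1)) (at ?x)"
    by (rule bounded_linear.has_derivative[OF bounded_linear_vec_nth u'])
  have "tensor_divergence (\<lambda>y. \<rho> y t *\<^sub>R outer (u y t) (u y t)) ?x $ 1
      = divergence (\<lambda>y. (\<rho> y t * u y t $ 1) *\<^sub>R u y t) ?x"
    by (simp add: tensor_divergence_def divergence_def outer_def mult.assoc)
  also have "\<dots> = (g r t * wr r t + gr r t * w r t) * w r t + g r t * w r t * (wr r t + 2 * (w r t / r))"
    using divergence_radial[OF t r has_derivative_mult[OF \<rho>' u1]] by simp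
  finally have 2: "tensor_divergence (\<lambda>y. \<rho> y t *\<^sub>R outer (u y t) (u y t)) ?x $ 1 = \<dots>" .
  have "((\<lambda>y. \<rho> y t powr \<gamma>) has_derivative
      (\<lambda>h. \<rho> ?x t powr \<gamma> * (0 * ln (\<rho> ?x t) + d\<rho> (?x, t) (h, 0) * \<gamma> / \<rho> ?x t))) (at ?x)"
    by (rule has_derivative_powr[OF \<rho>' has_derivative_const pos UNIV_I])
  from partial_eq[OF this, of 1]
  have 3: "gradient (\<lambda>y. \<rho> y t powr \<gamma>) ?x $ 1 = \<gamma> * g r t powr (\<gamma> - 1) * gr r t"
    using pos by (simp add: gradient_def powr_diff)
  from arg_cong[OF eq, of "\<lambda>v. v $ 1"] show ?thesis
    unfolding vector_add_component 1 2 3 radial_continuity_equation[OF t r]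
    by (simp add: algebra_simps)
qed

text \<open>The freely enlarged bound \<open>B'\<close> lets two flows share one constant, as
  \<open>radial_flow_uniqueness\<close> demands.\<close>

lemma radial_flow:
  assumes "B \<le> B'"
  shows "radial_flow \<gamma> T B' R R' g w gr gt wr wt"
proof (unfold_locales, goal_cases)
  case 1 show ?case by (rule \<gamma>)
next
  case 2 show ?case using T by simp
next
  case 3 then show ?case by (rule R_pos)
next
  case 4 then show ?case by (rule R_t)
next
  case 5 show ?case by (rule cont_R')
next
  case (6 r t)
  from ray_derivative[OF \<rho>_deriv 6] show ?case by (simp add: mult.commute)
next
  case (7 r t)
  from bounded_linear.has_derivative[OF bounded_linear_vec_nth ray_derivative[OF u_deriv 7], of 1]
  show ?case by (simp add: mult.commute)
next
  case 8 show ?case by (rule cont_ray[OF cont_d\<rho>])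
next
  case 9 show ?case by (rule cont_ray[OF cont_d\<rho>])
next
  case 10 show ?case by (rule continuous_on_component[OF cont_ray[OF cont_du]])
next
  case 11 show ?case by (rule continuous_on_component[OF cont_ray[OF cont_du]])
next
  case (12 r t) then show ?case using \<rho>_bound[OF ray_in_tube] assms by fastforce
next
  case (13 r t)
  have "\<bar>gr r t\<bar> \<le> norm (d\<rho> (r *\<^sub>R e\<^sub>1, t)) * norm (e\<^sub>1, 0::real)"
    using norm_blinfun[of "d\<rho> (r *\<^sub>R e\<^sub>1, t)" "(e\<^sub>1, 0)"] by simp
  then show ?case using d\<rho>_bound[OF ray_in_tube[OF 13]] assms by (simp add: norm_Pair)
next
  case (14 r t)
  have "\<bar>gt r t\<bar> \<le> norm (d\<rho> (r *\<^sub>R e\<^sub>1, t)) * norm (0::point, 1::real)"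
    using norm_blinfun[of "d\<rho> (r *\<^sub>R e\<^sub>1, t)" "(0, 1)"] by simp
  then show ?case using d\<rho>_bound[OF ray_in_tube[OF 14]] assms by (simp add: norm_Pair)
next
  case (15 r t)
  have "\<bar>w r t\<bar> \<le> norm (u (r *\<^sub>R e\<^sub>1) t)" by (rule component_le_norm_cart)
  then show ?case using u_bound[OF ray_in_tube[OF 15]] assms by linarith
next
  case (16 r t)
  have "\<bar>wr r t\<bar> \<le> norm (du (r *\<^sub>R e\<^sub>1, t) (e\<^sub>1, 0))" by (rule component_le_norm_cart)
  also have "\<dots> \<le> norm (du (r *\<^sub>R e\<^sub>1, t)) * norm (e\<^sub>1, 0::real)" by (rule norm_blinfun)
  finally show ?case using du_bound[OF ray_in_tube[OF 16]] assms by (simp add: norm_Pair)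
next
  case (17 r t)
  then have "t \<in> {0..T}" "0 < r" "r \<le> R t" by (auto simp: radial_domain_def)
  \<comment> \<open>The quotient is a tangential derivative of the velocity, so the gradient bound
    controls it up to the centre.\<close>
  from du_tangential[OF this, of 2]
  have "\<bar>w r t / r\<bar> = norm (du (r *\<^sub>R e\<^sub>1, t) (axis 2 1, 0))" by simp
  also have "\<dots> \<le> norm (du (r *\<^sub>R e\<^sub>1, t)) * norm (axis 2 1 :: point, 0::real)" by (rule norm_blinfun)
  finally show ?case using du_bound[OF ray_in_tube[OF 17]] assms by (simp add: norm_Pair)
next
  case (18 r t)
  have "norm (r *\<^sub>R e\<^sub>1) < R t" using 18 by simp
  then show ?case using solution_at[OF 18(1)] by blast
next
  case (19 t)
  have "norm (R t *\<^sub>R e\<^sub>1) = R t" using R_pos[OF 19] by simp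
  then show ?case using solution_at[OF 19] by blast
next
  case 20 then show ?case by (rule radial_continuity_equation)
next
  case 21 then show ?case by (rule radial_momentum_equation)
qed

lemma initial_data:
  assumes "norm x \<le> R\<^sub>0"
  shows "\<rho> x 0 = \<rho>\<^sub>0 x" "u x 0 = u\<^sub>0 x"
  using solution assms by (auto simp: euler_fb_solution_def)

lemma R_initial: "R 0 = R\<^sub>0"
  using solution by (simp add: euler_fb_solution_def)

lemma u_origin: "t \<in> {0..T} \<Longrightarrow> u 0 t = 0"
  using solution_at by blast

end

section \<open>From regular solutions to uniqueness\<close>

lemma regular_euler_flow_exists:
  assumes "\<gamma> > 1" "T > 0"
    and sol: "euler_fb_solution \<gamma> T R\<^sub>0 \<rho>\<^sub>0 u\<^sub>0 \<rho> u R" and reg: "regular_solution T \<rho> u R"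
  obtains R' d\<rho> du B where "regular_euler_flow \<gamma> T R\<^sub>0 \<rho>\<^sub>0 u\<^sub>0 \<rho> u R R' d\<rho> du B"
proof -
  let ?S = "punctured_tube T R"
  obtain dR where dR: "\<And>t. t \<in> {0..T} \<Longrightarrow> (R has_derivative blinfun_apply (dR t)) (at t within {0..T})"
    "continuous_on {0..T} dR"
    using reg unfolding regular_solution_def C1_on_def by blast
  obtain d\<rho> where d\<rho>: "\<And>p. p \<in> ?S \<Longrightarrow> ((\<lambda>(x, t). \<rho> x t) has_derivative blinfun_apply (d\<rho> p)) (at p within ?S)"
    "continuous_on ?S d\<rho>" "bounded ((\<lambda>(x, t). \<rho> x t) ` ?S)" "bounded (d\<rho> ` ?S)"
    using reg unfolding regular_solution_def C1_W1inf_on_def by blast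
  obtain du where du: "\<And>p. p \<in> ?S \<Longrightarrow> ((\<lambda>(x, t). u x t) has_derivative blinfun_apply (du p)) (at p within ?S)"
    "continuous_on ?S du" "bounded ((\<lambda>(x, t). u x t) ` ?S)" "bounded (du ` ?S)"
    using reg unfolding regular_solution_def C1_W1inf_on_def by blast
  obtain a where a: "\<forall>y\<in>(\<lambda>(x, t). \<rho> x t) ` ?S. norm y \<le> a" using d\<rho>(3) bounded_iff by blast
  obtain b where b: "\<forall>y\<in>d\<rho> ` ?S. norm y \<le> b" using d\<rho>(4) bounded_iff by blast
  obtain c where c: "\<forall>y\<in>(\<lambda>(x, t). u x t) ` ?S. norm y \<le> c" using du(3) bounded_iff by blast
  obtain d where d: "\<forall>y\<in>du ` ?S. norm y \<le> d" using du(4) bounded_iff by blast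
  have 1: "(R has_real_derivative dR t 1) (at t within {0..T})" if "t \<in> {0..T}" for t
  proof -
    have "blinfun_apply (dR t) = (*) (dR t 1)"
    proof
      fix h
      have "dR t (h *\<^sub>R 1) = h *\<^sub>R dR t 1" by (rule blinfun.scaleR_right)
      then show "dR t h = dR t 1 * h" by (simp only: real_scaleR_def mult.right_neutral mult.commute[of h])
    qed
    then show ?thesis using dR(1)[OF that] by (simp add: has_field_derivative_def)
  qed
  have "regular_euler_flow \<gamma> T R\<^sub>0 \<rho>\<^sub>0 u\<^sub>0 \<rho> u R (\<lambda>t. dR t 1) d\<rho> du (max (max a b) (max c d))"
  proof (unfold_locales, goal_cases)
    case 5 show ?case by (intro continuous_intros dR(2))
  next
    case (10 x t)
    then have "norm (\<rho> x t) \<le> a" using bspec[OF a imageI[OF 10]] by simp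
    then show ?case by simp
  next
    case (11 x t)
    then have "norm (u x t) \<le> c" using bspec[OF c imageI[OF 11]] by simp
    then show ?case by simp
  next
    case (12 p)
    then have "norm (d\<rho> p) \<le> b" using bspec[OF b imageI[OF 12]] by simp
    then show ?case by simp
  next
    case (13 p)
    then have "norm (du p) \<le> d" using bspec[OF d imageI[OF 13]] by simp
    then show ?case by simp
  qed (rule assms 1 d\<rho> du; assumption?)+
  then show ?thesis by (rule that)
qed

theorem corollary11p2:
  fixes \<gamma> T R\<^sub>0 :: real
    and \<rho>\<^sub>0 :: "point \<Rightarrow> real" and u\<^sub>0 :: "point \<Rightarrow> point"
    and \<rho>\<^sub>1 \<rho>\<^sub>2 :: "point \<Rightarrow> real \<Rightarrow> real" and u\<^sub>1 u\<^sub>2 :: "point \<Rightarrow> real \<Rightarrow> point"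
    and R\<^sub>1 R\<^sub>2 :: "real \<Rightarrow> real"
  assumes "\<gamma> > 1" and "T > 0" and "R\<^sub>0 > 0"
    and "radial_scalar_on (cball 0 R\<^sub>0) \<rho>\<^sub>0" and "radial_vector_on (cball 0 R\<^sub>0) u\<^sub>0"
    and "euler_fb_solution \<gamma> T R\<^sub>0 \<rho>\<^sub>0 u\<^sub>0 \<rho>\<^sub>1 u\<^sub>1 R\<^sub>1" and "regular_solution T \<rho>\<^sub>1 u\<^sub>1 R\<^sub>1"
    and "euler_fb_solution \<gamma> T R\<^sub>0 \<rho>\<^sub>0 u\<^sub>0 \<rho>\<^sub>2 u\<^sub>2 R\<^sub>2" and "regular_solution T \<rho>\<^sub>2 u\<^sub>2 R\<^sub>2"
  shows "\<forall>t\<in>{0..T}. R\<^sub>1 t = R\<^sub>2 t \<and>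
           (\<forall>x. norm x \<le> R\<^sub>1 t \<longrightarrow> \<rho>\<^sub>1 x t = \<rho>\<^sub>2 x t \<and> u\<^sub>1 x t = u\<^sub>2 x t)"
proof (intro ballI)
  fix t assume t: "t \<in> {0..T}"
  obtain R\<^sub>1' d\<rho>\<^sub>1 du\<^sub>1 B\<^sub>1 where 1: "regular_euler_flow \<gamma> T R\<^sub>0 \<rho>\<^sub>0 u\<^sub>0 \<rho>\<^sub>1 u\<^sub>1 R\<^sub>1 R\<^sub>1' d\<rho>\<^sub>1 du\<^sub>1 B\<^sub>1"
    using regular_euler_flow_exists[OF assms(1,2,6,7)] .
  obtain R\<^sub>2' d\<rho>\<^sub>2 du\<^sub>2 B\<^sub>2 where 2: "regular_euler_flow \<gamma> T R\<^sub>0 \<rho>\<^sub>0 u\<^sub>0 \<rho>\<^sub>2 u\<^sub>2 R\<^sub>2 R\<^sub>2' d\<rho>\<^sub>2 du\<^sub>2 B\<^sub>2"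
    using regular_euler_flow_exists[OF assms(1,2,8,9)] .
  interpret F1: regular_euler_flow \<gamma> T R\<^sub>0 \<rho>\<^sub>0 u\<^sub>0 \<rho>\<^sub>1 u\<^sub>1 R\<^sub>1 R\<^sub>1' d\<rho>\<^sub>1 du\<^sub>1 B\<^sub>1 by (rule 1)
  interpret F2: regular_euler_flow \<gamma> T R\<^sub>0 \<rho>\<^sub>0 u\<^sub>0 \<rho>\<^sub>2 u\<^sub>2 R\<^sub>2 R\<^sub>2' d\<rho>\<^sub>2 du\<^sub>2 B\<^sub>2 by (rule 2)
  have init: "F1.g r 0 = F2.g r 0 \<and> F1.w r 0 = F2.w r 0" if "0 < r" "r \<le> R\<^sub>1 0" for r
    using that F1.initial_data[of "r *\<^sub>R e\<^sub>1"] F2.initial_data[of "r *\<^sub>R e\<^sub>1"] F1.R_initial by simp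
  note U = radial_flow_uniqueness[OF F1.radial_flow[of "max B\<^sub>1 B\<^sub>2", OF max.cobounded1]
      F2.radial_flow[of "max B\<^sub>1 B\<^sub>2", OF max.cobounded2] _ init t]
  have R: "R\<^sub>1 t = R\<^sub>2 t" using U(1) F1.R_initial F2.R_initial by simp
  have gw: "F1.g r t = F2.g r t \<and> F1.w r t = F2.w r t" if "0 < r" "r \<le> R\<^sub>1 t" for r
    using U(2) that F1.R_initial F2.R_initial by simp
  have "\<rho>\<^sub>1 x t = \<rho>\<^sub>2 x t \<and> u\<^sub>1 x t = u\<^sub>2 x t" if x: "norm x \<le> R\<^sub>1 t" for x
  proof (cases "x = 0")
    case False
    then show ?thesis
      using gw[of "norm x"] x R F1.\<rho>_radial[OF t x] F2.\<rho>_radial[OF t, of x]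
        F1.u_radial[OF t _ x] F2.u_radial[OF t, of x] by simp
  next
    case True
    \<comment> \<open>The comparison of profiles covers only \<open>r > 0\<close>. At the origin the
      density is recovered from its continuity on the ball, and the velocities agree because both
      vanish there.\<close>
    have lim: "((\<lambda>r. f (r *\<^sub>R e\<^sub>1)) \<longlongrightarrow> f 0) (at_right 0)"
      if "continuous_on (cball 0 (R\<^sub>1 t)) f" for f :: "point \<Rightarrow> real"
    proof (rule continuous_on_tendsto_compose[OF that])
      have "((\<lambda>r. r *\<^sub>R e\<^sub>1) \<longlongrightarrow> 0 *\<^sub>R e\<^sub>1) (at_right 0)" by (intro tendsto_intros)
      then show "((\<lambda>r. r *\<^sub>R e\<^sub>1) \<longlongrightarrow> 0) (at_right 0)" by simp
      show "0 \<in> cball 0 (R\<^sub>1 t)" using F1.R_pos[OF t] by simp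
      show "\<forall>\<^sub>F r in at_right 0. r *\<^sub>R e\<^sub>1 \<in> cball 0 (R\<^sub>1 t)"
        using eventually_at_right_real[OF F1.R_pos[OF t]] by eventually_elim simp
    qed
    have cont\<^sub>1: "continuous_on (cball 0 (R\<^sub>1 t)) (\<lambda>x. \<rho>\<^sub>1 x t)"
      using assms(7) t by (simp add: regular_solution_def)
    have cont\<^sub>2: "continuous_on (cball 0 (R\<^sub>1 t)) (\<lambda>x. \<rho>\<^sub>2 x t)"
      using assms(9) t unfolding R by (simp add: regular_solution_def)
    have "\<forall>\<^sub>F r in at_right 0. F1.g r t = F2.g r t"
      using eventually_at_right_real[OF F1.R_pos[OF t]] by eventually_elim (use gw in auto)
    then have "((\<lambda>r. F2.g r t) \<longlongrightarrow> \<rho>\<^sub>1 0 t) (at_right 0)"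
      using lim[OF cont\<^sub>1] by (simp add: tendsto_cong)
    then have "\<rho>\<^sub>1 0 t = \<rho>\<^sub>2 0 t"
      using tendsto_unique[OF trivial_limit_at_right_real _ lim[OF cont\<^sub>2]] by blast
    then show ?thesis using True F1.u_origin[OF t] F2.u_origin[OF t] by simp
  qed
  then show "R\<^sub>1 t = R\<^sub>2 t \<and> (\<forall>x. norm x \<le> R\<^sub>1 t \<longrightarrow> \<rho>\<^sub>1 x t = \<rho>\<^sub>2 x t \<and> u\<^sub>1 x t = u\<^sub>2 x t)"
    using R by simp
qed

end
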